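(* For every $0<\varepsilon\le 1$ there exist $\lambda>0$ and $n_0$ such that for all $n>n_0$ and every $p\ge \lambda n^{-1/2}$ the following holds: with probability at least $1-\varepsilon$, over the choice of the random graph $G(n,p)$ and the choice of the initial state, all vertices of $V_n=\{1,\dots,n\}$ have state $\operatorname{sgn}\bigl(\sum_{v\in V_n}S_0(v)\bigr)$ after four rounds of majority dynamics, i.e. $S_4(v)=\operatorname{sgn}\bigl(\sum_{u\in V_n}S_0(u)\bigr)$ for all $v\in V_n$.
   Context: $G(n,p)$ is the binomial random graph on $V_n=\{1,\dots,n\}$ in which each pair of distinct vertices is an edge independently with probability $p$. Majority dynamics on a graph $G$: each vertex $v$ has a state $S_t(v)\in\{-1,+1\}$ at step $t\ge 0$, and $S_{t+1}(v)=\operatorname{sgn}\bigl(\sum_{u\in N(v)}S_t(u)\bigr)$ if this sum is nonzero, and $S_{t+1}(v)=S_t(v)$ otherwise, where $N(v)$ is the neighbourhood of $v$ in $G$ and $\operatorname{sgn}(x)=-1$ for $x<0$, $+1$ for $x>0$. The initial states $\{S_0(v)\}_{v\in V_n}$ are independent, each uniform on $\{-1,+1\}$, independent of the graph. *)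

theory Defs
  imports "HOL-Probability.Probability"
begin

definition vertices :: "nat \<Rightarrow> nat set" where
  "vertices n = {1..n}"

definition pairs :: "nat \<Rightarrow> nat set set" where
  "pairs n = {{u, v} | u v. u \<in> vertices n \<and> v \<in> vertices n \<and> u \<noteq> v}"

text \<open>G(n,p): each potential edge present independently with probability p
  (a graph is represented by the indicator of its edge set).\<close>
definition gnp :: "nat \<Rightarrow> real \<Rightarrow> (nat set \<Rightarrow> bool) pmf" where
  "gnp n p = Pi_pmf (pairs n) False (\<lambda>_. bernoulli_pmf p)"

definition init_states :: "nat \<Rightarrow> (nat \<Rightarrow> int) pmf" where
  "init_states n = Pi_pmf (vertices n) 0 (\<lambda>_. pmf_of_set {-1, 1})"

definition nbhd :: "nat \<Rightarrow> (nat set \<Rightarrow> bool) \<Rightarrow> nat \<Rightarrow> nat set" where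
  "nbhd n G v = {u \<in> vertices n. u \<noteq> v \<and> G {u, v}}"

definition maj_step :: "nat \<Rightarrow> (nat set \<Rightarrow> bool) \<Rightarrow> (nat \<Rightarrow> int) \<Rightarrow> (nat \<Rightarrow> int)" where
  "maj_step n G S = (\<lambda>v. let s = (\<Sum>u\<in>nbhd n G v. S u) in
      if s \<noteq> 0 then sgn s else S v)"

definition maj_state :: "nat \<Rightarrow> (nat set \<Rightarrow> bool) \<Rightarrow> (nat \<Rightarrow> int) \<Rightarrow> nat \<Rightarrow> (nat \<Rightarrow> int)" where
  "maj_state n G S0 t = (maj_step n G ^^ t) S0"

end

theory Submission
  imports Defs "HOL-Real_Asymp.Real_Asymp"
begin

text \<open>
  With probability close to 1 the initial sum has absolute value at least \<open>c \<surd>n\<close>; fix such an initial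
  state, by symmetry with positive sum. Fix a vertex \<open>v\<close>. Conditionally on being a neighbour of \<open>v\<close>,
  a vertex \<open>u\<close> is positive after one round with bias at least of order \<open>c \<surd>p\<close>: the sum over its neighbours
  is \<open>Z + D\<close> with \<open>Z\<close> symmetric and unimodal of variance at most \<open>p n\<close>, and \<open>D\<close> an independent binomial of mean
  about \<open>c p \<surd>n\<close>. Two such vertices \<open>u\<close>, \<open>u'\<close> interact only through the edge \<open>{u, u'}\<close>, so their covariance
  is a product of first-level Fourier coefficients, and Bessel's inequality bounds the total covariance by
  \<open>n\<close>. Hence the sum over the neighbours of \<open>v\<close> after one round has mean of order \<open>c p n \<surd>p\<close> and variance
  at most \<open>2 p n\<close>, and by Chebyshev \<open>v\<close> is wrong after two rounds with probability \<open>O(1 / (c\<^sup>2 p\<^sup>2 n))\<close>. So at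
  most \<open>n / 32\<close> vertices are wrong after two rounds. By a Chernoff and union bound, no set of at most
  \<open>n / 32\<close> vertices meets half of the neighbourhood of \<open>p n / 10\<close> or more vertices, so fewer than
  \<open>p n / 10\<close> vertices are wrong after three rounds; this is less than half of the minimum degree, and after four
  rounds no vertex is wrong.
\<close>

section \<open>Independent Bernoulli bits\<close>

abbreviation bits :: "'e set \<Rightarrow> real \<Rightarrow> ('e \<Rightarrow> bool) pmf" where
  "bits E p \<equiv> Pi_pmf E False (\<lambda>_. bernoulli_pmf p)"

abbreviation "Mean \<equiv> measure_pmf.expectation"
abbreviation "Pr \<equiv> measure_pmf.prob"

text \<open>Plays the role of measurability with respect to the bits in \<open>A\<close>: functions
  depending on disjoint sets are independent under \<open>bits\<close>.\<close>

definition depends_on :: "(('e \<Rightarrow> bool) \<Rightarrow> 'b) \<Rightarrow> 'e set \<Rightarrow> bool" where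
  "depends_on f A \<longleftrightarrow> (\<forall>G H. (\<forall>e\<in>A. G e = H e) \<longrightarrow> f G = f H)"

lemma depends_onD: "depends_on f A \<Longrightarrow> (\<And>e. e \<in> A \<Longrightarrow> G e = H e) \<Longrightarrow> f G = f H"
  by (auto simp: depends_on_def)

lemma depends_on_mono: "depends_on f A \<Longrightarrow> A \<subseteq> B \<Longrightarrow> depends_on f B"
  by (auto simp: depends_on_def)

lemma depends_on_comp2: "depends_on f A \<Longrightarrow> depends_on g A \<Longrightarrow> depends_on (\<lambda>G. h (f G) (g G)) A"
  unfolding depends_on_def by metis

lemma depends_on_bit: "depends_on (\<lambda>G. h (G e)) {e}"
  by (simp add: depends_on_def)

lemma finite_set_bits: "finite E \<Longrightarrow> finite (set_pmf (bits E p))"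
  by (subst set_Pi_pmf) auto

lemma integrable_finite_set_pmf:
  fixes f :: "_ \<Rightarrow> real"
  shows "finite (set_pmf P) \<Longrightarrow> integrable P f"
  by (rule integrable_measure_pmf_finite)

lemma expectation_pair_pmf_finite:
  fixes h :: "_ \<Rightarrow> real"
  assumes "finite (set_pmf P)" "finite (set_pmf Q)"
  shows "Mean (pair_pmf P Q) h = Mean P (\<lambda>x. Mean Q (\<lambda>y. h (x, y)))"
proof -
  have "Mean (pair_pmf P Q) h = Mean (bind_pmf P (\<lambda>x. map_pmf (Pair x) Q)) h"
    by (simp add: pair_pmf_def map_pmf_def)
  also have "\<dots> = (\<Sum>a\<in>set_pmf P. pmf P a *\<^sub>R Mean (map_pmf (Pair a) Q) h)"
    using assms by (intro pmf_expectation_bind) auto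
  also have "\<dots> = Mean P (\<lambda>x. Mean Q (\<lambda>y. h (x, y)))"
    using assms by (subst integral_measure_pmf[of "set_pmf P"]) (auto simp: set_pmf_eq)
  finally show ?thesis .
qed

text \<open>The product measure splits into independent blocks on \<open>E \<inter> A\<close> and
  \<open>E - A\<close>; \<open>f\<close> sees only the first block and \<open>g\<close> only the
  second, so Fubini factorises the mean.\<close>

lemma expectation_indep:
  fixes f g :: "_ \<Rightarrow> real"
  assumes E: "finite E" and f: "depends_on f A" and g: "depends_on g B" and AB: "A \<inter> B = {}"
  shows "Mean (bits E p) (\<lambda>G. f G * g G) = Mean (bits E p) f * Mean (bits E p) g"
proof -
  let ?A = "E \<inter> A" and ?B = "E - A"
  let ?j = "\<lambda>(F, H) x. if x \<in> ?A then F x else H x :: bool"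
  have split: "bits E p = map_pmf ?j (pair_pmf (bits ?A p) (bits ?B p))"
    using Pi_pmf_union[of ?A ?B False "\<lambda>_. bernoulli_pmf p"] E by (simp add: Int_Diff_Un Int_Diff_disjoint)
  \<comment> \<open>\<open>A\<close> may contain coordinates outside \<open>E\<close>; on the
    supports both blocks have the default value \<open>False\<close> there, so \<open>f\<close>
    still reads only \<open>F\<close>.\<close>
  have fA: "f (?j (F, H)) = f F" if "H \<in> set_pmf (bits ?B p)" "F \<in> set_pmf (bits ?A p)" for F H
  proof (rule depends_onD[OF f])
    fix e assume e: "e \<in> A"
    have "\<not> F e \<and> \<not> H e" if "e \<notin> E"
      using that E subsetD[OF set_Pi_pmf_subset \<open>H \<in> _\<close>] subsetD[OF set_Pi_pmf_subset \<open>F \<in> _\<close>] by auto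
    then show "?j (F, H) e = F e" using e by auto
  qed
  have gB: "g (?j (F, H)) = g H" for F H
    using AB by (intro depends_onD[OF g]) auto
  have fin: "finite (set_pmf (bits ?A p))" "finite (set_pmf (bits ?B p))"
    using E by (auto intro!: finite_set_bits)
  \<comment> \<open>\<open>u\<close> and \<open>w\<close> will be the identity or the constant 1, so
    that one computation yields the mean of the product and both marginal means.\<close>
  have ex: "Mean (bits E p) (\<lambda>G. u (f G) * w (g G)) = Mean (bits ?A p) (\<lambda>F. u (f F)) * Mean (bits ?B p) (\<lambda>H. w (g H))"
    for u w :: "real \<Rightarrow> real"
  proof -
    have "Mean (bits E p) (\<lambda>G. u (f G) * w (g G))
      = Mean (bits ?A p) (\<lambda>F. Mean (bits ?B p) (\<lambda>H. u (f (?j (F, H))) * w (g (?j (F, H)))))"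
      by (subst split) (simp add: expectation_pair_pmf_finite[OF fin] case_prod_beta)
    also have "\<dots> = Mean (bits ?A p) (\<lambda>F. Mean (bits ?B p) (\<lambda>H. u (f F) * w (g H)))"
    proof (rule integral_cong_AE)
      have "Mean (bits ?B p) (\<lambda>H. u (f (?j (F, H))) * w (g (?j (F, H)))) = Mean (bits ?B p) (\<lambda>H. u (f F) * w (g H))"
        if "F \<in> set_pmf (bits ?A p)" for F
        by (rule integral_cong_AE, simp, simp, unfold AE_measure_pmf_iff)
          (intro ballI, simp only: fA[OF _ that] gB)
      then show "AE F in bits ?A p. Mean (bits ?B p) (\<lambda>H. u (f (?j (F, H))) * w (g (?j (F, H))))
          = Mean (bits ?B p) (\<lambda>H. u (f F) * w (g H))"
        unfolding AE_measure_pmf_iff by blast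
    qed simp_all
    also have "\<dots> = Mean (bits ?A p) (\<lambda>F. u (f F)) * Mean (bits ?B p) (\<lambda>H. w (g H))"
      by simp
    finally show ?thesis .
  qed
  show ?thesis
    using ex[of "\<lambda>x. x" "\<lambda>x. x"] ex[of "\<lambda>x. x" "\<lambda>_. 1"] ex[of "\<lambda>_. 1" "\<lambda>x. x"] by simp
qed

lemma expectation_bit:
  fixes h :: "bool \<Rightarrow> real"
  assumes "finite E" "e \<in> E" "0 \<le> p" "p \<le> 1"
  shows "Mean (bits E p) (\<lambda>G. h (G e)) = p * h True + (1 - p) * h False"
proof -
  have "Mean (bits E p) (\<lambda>G. h (G e)) = Mean (map_pmf (\<lambda>G. G e) (bits E p)) h"
    by simp
  also have "\<dots> = Mean (bernoulli_pmf p) h"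
    using assms by (subst Pi_pmf_component) auto
  finally show ?thesis using assms by simp
qed

section \<open>Mean discrete derivatives and covariances\<close>

definition influence :: "'e set \<Rightarrow> real \<Rightarrow> (('e \<Rightarrow> bool) \<Rightarrow> real) \<Rightarrow> 'e \<Rightarrow> real" where
  "influence E p f e = Mean (bits E p) (\<lambda>G. f (G(e := True)) - f (G(e := False)))"

text \<open>Write f = a + b x with x the bit at \<open>e\<close> and a, b not depending on it. The
  term a integrates to 0 against x - p, and x (x - p) = x (1 - p) leaves p (1 - p) times the mean of
  b, which is the (signed) influence.\<close>

lemma expectation_mult_centred_bit:
  fixes f :: "_ \<Rightarrow> real"
  assumes "finite E" "e \<in> E" "0 \<le> p" "p \<le> 1"
  shows "Mean (bits E p) (\<lambda>G. f G * (of_bool (G e) - p)) = p * (1 - p) * influence E p f e"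
proof -
  let ?a = "\<lambda>G. f (G(e := False))" and ?b = "\<lambda>G. f (G(e := True)) - f (G(e := False))"
  let ?c = "\<lambda>G. (of_bool (G e) - p :: real)"
  have int: "integrable (bits E p) h" for h :: "_ \<Rightarrow> real"
    using assms by (intro integrable_finite_set_pmf finite_set_bits)
  have "f G * ?c G = ?a G * ?c G + ?b G * (of_bool (G e) * (1 - p))" for G
    by (cases "G e") (auto simp: algebra_simps fun_upd_idem)
  then have "Mean (bits E p) (\<lambda>G. f G * ?c G)
      = Mean (bits E p) (\<lambda>G. ?a G * ?c G) + Mean (bits E p) (\<lambda>G. ?b G * (of_bool (G e) * (1 - p)))"
    by (simp add: int)
  moreover have "Mean (bits E p) (\<lambda>G. ?a G * ?c G) = Mean (bits E p) ?a * Mean (bits E p) ?c"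
    by (rule expectation_indep[of _ _ "-{e}" _ "{e}"])
      (use assms in \<open>auto simp: depends_on_def intro!: arg_cong[where f=f] ext\<close>)
  moreover have "Mean (bits E p) ?c = 0"
    using expectation_bit[OF assms, of "\<lambda>b. of_bool b - p"] by (simp add: algebra_simps)
  moreover have "Mean (bits E p) (\<lambda>G. ?b G * (of_bool (G e) * (1 - p)))
      = Mean (bits E p) ?b * Mean (bits E p) (\<lambda>G. of_bool (G e) * (1 - p))"
    by (rule expectation_indep[of _ _ "-{e}" _ "{e}"])
      (use assms in \<open>auto simp: depends_on_def fun_upd_def intro!: arg_cong2[where f="(-)"] arg_cong[where f=f]\<close>)
  moreover have "Mean (bits E p) (\<lambda>G. of_bool (G e) * (1 - p)) = p * (1 - p)"
    using expectation_bit[OF assms, of "\<lambda>b. of_bool b * (1 - p)"] by (simp add: algebra_simps)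
  ultimately show ?thesis
    unfolding influence_def by simp
qed

text \<open>The influences of the single bits are the first-level Fourier coefficients of \<open>f\<close>, so this is
  Bessel's inequality.\<close>

lemma sum_influence_le:
  fixes f :: "_ \<Rightarrow> real"
  assumes E: "finite E" and F: "F \<subseteq> E" and p: "0 \<le> p" "p \<le> 1"
  shows "(\<Sum>e\<in>F. p * (1 - p) * (influence E p f e)\<^sup>2) \<le> Mean (bits E p) (\<lambda>G. (f G)\<^sup>2)"
proof -
  let ?b = "influence E p f" and ?c = "\<lambda>e G. (of_bool (G e) - p :: real)"
  have finF: "finite F" using E F finite_subset by auto
  have int [simp]: "integrable (bits E p) h" for h :: "_ \<Rightarrow> real"
    using E by (intro integrable_finite_set_pmf finite_set_bits)
  have cc: "Mean (bits E p) (\<lambda>G. ?c e G * ?c e' G) = (if e = e' then p * (1 - p) else 0)"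
    if "e \<in> F" "e' \<in> F" for e e'
  proof -
    \<comment> \<open>The centred bits are orthogonal: in
      \<open>expectation_mult_centred_bit\<close> take for \<open>f\<close> a centred bit, whose
      influences are 0 or 1.\<close>
    have "influence E p (?c e) e' = of_bool (e = e')"
      by (auto simp: influence_def)
    then show ?thesis
      using expectation_mult_centred_bit[of E e' p "?c e"] E F p that by auto
  qed
  have "0 \<le> Mean (bits E p) (\<lambda>G. (f G - (\<Sum>e\<in>F. ?b e * ?c e G))\<^sup>2)"
    by (intro integral_nonneg_AE) auto
  also have "(\<lambda>G. (f G - (\<Sum>e\<in>F. ?b e * ?c e G))\<^sup>2)
      = (\<lambda>G. (f G)\<^sup>2 - 2 * (\<Sum>e\<in>F. ?b e * (f G * ?c e G))
          + (\<Sum>e\<in>F. \<Sum>e'\<in>F. ?b e * ?b e' * (?c e G * ?c e' G)))"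
    by (simp add: power2_eq_square algebra_simps sum_distrib_left sum_distrib_right sum_product)
  also have "Mean (bits E p) \<dots> = Mean (bits E p) (\<lambda>G. (f G)\<^sup>2)
      - 2 * (\<Sum>e\<in>F. ?b e * Mean (bits E p) (\<lambda>G. f G * ?c e G))
      + (\<Sum>e\<in>F. \<Sum>e'\<in>F. ?b e * ?b e' * Mean (bits E p) (\<lambda>G. ?c e G * ?c e' G))"
    by (simp add: Bochner_Integration.integral_sum)
  also have "(\<Sum>e\<in>F. ?b e * Mean (bits E p) (\<lambda>G. f G * ?c e G)) = (\<Sum>e\<in>F. p * (1 - p) * (?b e)\<^sup>2)"
    using F p E by (intro sum.cong) (auto simp: expectation_mult_centred_bit power2_eq_square subset_iff)
  also have "(\<Sum>e\<in>F. \<Sum>e'\<in>F. ?b e * ?b e' * Mean (bits E p) (\<lambda>G. ?c e G * ?c e' G))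
      = (\<Sum>e\<in>F. \<Sum>e'\<in>F. if e = e' then p * (1 - p) * (?b e)\<^sup>2 else 0)"
    by (intro sum.cong refl) (auto simp: cc power2_eq_square)
  also have "\<dots> = (\<Sum>e\<in>F. p * (1 - p) * (?b e)\<^sup>2)"
    using finF by simp
  finally show ?thesis by simp
qed

text \<open>With x the shared bit, f = a + b x and g = a' + b' x, where a, b depend only on
  \<open>A\<close> and a', b' only on \<open>B\<close>. The pairs (a, b), (a', b') and x are
  independent, so the covariance is the mean of b times the mean of b' times the variance p (1 - p)
  of x.\<close>

lemma covariance_sharing_one_bit:
  fixes f g :: "_ \<Rightarrow> real"
  assumes E: "finite E" "e \<in> E" and p: "0 \<le> p" "p \<le> 1"
    and f: "depends_on f (insert e A)" and g: "depends_on g (insert e B)"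
    and AB: "A \<inter> B = {}" "e \<notin> A" "e \<notin> B"
  shows "Mean (bits E p) (\<lambda>G. f G * g G) = Mean (bits E p) f * Mean (bits E p) g
      + p * (1 - p) * influence E p f e * influence E p g e"
proof -
  let ?a = "\<lambda>G. f (G(e := False))" and ?b = "\<lambda>G. f (G(e := True)) - f (G(e := False))"
  let ?a' = "\<lambda>G. g (G(e := False))" and ?b' = "\<lambda>G. g (G(e := True)) - g (G(e := False))"
  let ?x = "\<lambda>G. (of_bool (G e) :: real)"
  have int [simp]: "integrable (bits E p) h" for h :: "_ \<Rightarrow> real"
    using E by (intro integrable_finite_set_pmf finite_set_bits)
  have upd: "depends_on (\<lambda>G. h (G(e := c))) C" if "depends_on h (insert e C)" for h :: "_ \<Rightarrow> real" and c C
    unfolding depends_on_def using that by (auto intro!: depends_onD[OF that])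
  have dep: "depends_on ?a A" "depends_on ?b A" "depends_on ?a' B" "depends_on ?b' B"
    by (intro upd f g depends_on_comp2[where h="(-)"])+
  have x: "Mean (bits E p) ?x = p"
    using expectation_bit[OF E p, of of_bool] by simp
  have xx: "Mean (bits E p) (\<lambda>G. h G * ?x G) = Mean (bits E p) h * p" if "depends_on h C" "e \<notin> C"
    for h :: "_ \<Rightarrow> real" and C
    using expectation_indep[OF E(1) that(1) depends_on_bit[of of_bool e], of p] that(2) x by simp
  have prod: "Mean (bits E p) (\<lambda>G. h G * k G) = Mean (bits E p) h * Mean (bits E p) k"
    if "depends_on h A" "depends_on k B" for h k :: "_ \<Rightarrow> real"
    using expectation_indep[OF E(1) that] AB by simp
  have prodx: "Mean (bits E p) (\<lambda>G. h G * k G * ?x G) = Mean (bits E p) h * Mean (bits E p) k * p"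
    if h: "depends_on h A" and k: "depends_on k B" for h k :: "_ \<Rightarrow> real"
  proof -
    have "depends_on (\<lambda>G. h G * k G) (A \<union> B)"
      by (intro depends_on_comp2[where h="(*)"] depends_on_mono[OF h] depends_on_mono[OF k]) auto
    from xx[OF this] show ?thesis using AB prod[OF h k] by simp
  qed
  have decf: "f G = ?a G + ?b G * ?x G" and decg: "g G = ?a' G + ?b' G * ?x G" for G
    by (cases "G e"; simp add: fun_upd_idem)+
  have Ef: "Mean (bits E p) f = Mean (bits E p) ?a + Mean (bits E p) ?b * p"
  proof -
    have "Mean (bits E p) f = Mean (bits E p) (\<lambda>G. ?a G + ?b G * ?x G)"
      by (rule arg_cong[where f="Mean (bits E p)"], rule ext, rule decf)
    also have "\<dots> = Mean (bits E p) ?a + Mean (bits E p) (\<lambda>G. ?b G * ?x G)"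
      by (rule Bochner_Integration.integral_add[OF int int])
    finally show ?thesis unfolding xx[OF dep(2) AB(2)] .
  qed
  have Eg: "Mean (bits E p) g = Mean (bits E p) ?a' + Mean (bits E p) ?b' * p"
  proof -
    have "Mean (bits E p) g = Mean (bits E p) (\<lambda>G. ?a' G + ?b' G * ?x G)"
      by (rule arg_cong[where f="Mean (bits E p)"], rule ext, rule decg)
    also have "\<dots> = Mean (bits E p) ?a' + Mean (bits E p) (\<lambda>G. ?b' G * ?x G)"
      by (rule Bochner_Integration.integral_add[OF int int])
    finally show ?thesis unfolding xx[OF dep(4) AB(3)] .
  qed
  have "(\<lambda>G. f G * g G) = (\<lambda>G. ?a G * ?a' G + ?a G * ?b' G * ?x G + ?b G * ?a' G * ?x G + ?b G * ?b' G * ?x G)"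
  proof
    fix G show "f G * g G = ?a G * ?a' G + ?a G * ?b' G * ?x G + ?b G * ?a' G * ?x G + ?b G * ?b' G * ?x G"
      by (cases "G e") (auto simp: fun_upd_idem algebra_simps)
  qed
  then have "Mean (bits E p) (\<lambda>G. f G * g G) = Mean (bits E p) (\<lambda>G. ?a G * ?a' G)
     + Mean (bits E p) (\<lambda>G. ?a G * ?b' G * ?x G) + Mean (bits E p) (\<lambda>G. ?b G * ?a' G * ?x G)
     + Mean (bits E p) (\<lambda>G. ?b G * ?b' G * ?x G)"
    by (simp only: Bochner_Integration.integral_add[OF int int])
  also have "\<dots> = Mean (bits E p) ?a * Mean (bits E p) ?a' + Mean (bits E p) ?a * Mean (bits E p) ?b' * p
     + Mean (bits E p) ?b * Mean (bits E p) ?a' * p + Mean (bits E p) ?b * Mean (bits E p) ?b' * p"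
    by (simp only: prod[OF dep(1,3)] prodx[OF dep(1,4)] prodx[OF dep(2,3)] prodx[OF dep(2,4)])
  finally show ?thesis
    unfolding Ef Eg influence_def by algebra
qed

section \<open>Moment and exponential tail bounds\<close>

lemma prob_eq_expectation: "Pr M {x. P x} = Mean M (\<lambda>x. of_bool (P x))"
proof -
  have "(\<lambda>x. of_bool (P x) :: real) = indicator {x. P x}"
    by (auto simp: indicator_def)
  then show ?thesis by simp
qed

text \<open>Markov's inequality with an arbitrary majorant of the indicator; the Chebyshev and
  Chernoff bounds below are instances.\<close>

lemma prob_le_expectation:
  assumes "finite (set_pmf M)" "\<And>x. x \<in> set_pmf M \<Longrightarrow> 0 \<le> f x" "\<And>x. x \<in> set_pmf M \<Longrightarrow> P x \<Longrightarrow> 1 \<le> f x"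
  shows "Pr M {x. P x} \<le> Mean M f"
  unfolding prob_eq_expectation
  by (rule integral_mono_AE)
    (use assms in \<open>auto intro: integrable_finite_set_pmf simp: AE_measure_pmf_iff of_bool_def\<close>)

lemma Chebyshev_prob:
  fixes X :: "_ \<Rightarrow> real"
  assumes fin: "finite (set_pmf M)" and r: "0 < r"
  shows "Pr M {x. r \<le> \<bar>X x\<bar>} \<le> Mean M (\<lambda>x. (X x)\<^sup>2) / r\<^sup>2"
proof -
  have "Pr M {x. r \<le> \<bar>X x\<bar>} \<le> Mean M (\<lambda>x. (X x)\<^sup>2 / r\<^sup>2)"
    using r by (intro prob_le_expectation fin) (auto simp: field_simps abs_le_square_iff[symmetric])
  then show ?thesis by simp
qed

text \<open>Exponential Markov inequality with parameter 1, any tilt being absorbed into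
  \<open>c\<close>. Each bit contributes the factor 1 + p (exp (c e) - 1), which is bounded by means
  of 1 + y \<le> exp y.\<close>

lemma Chernoff_bits:
  fixes c :: "'e \<Rightarrow> real"
  assumes E: "finite E" and p: "0 \<le> p" "p \<le> 1"
  shows "Pr (bits E p) {G. a \<le> (\<Sum>e\<in>E. c e * of_bool (G e))} \<le> exp (p * (\<Sum>e\<in>E. exp (c e) - 1) - a)"
proof -
  have "Pr (bits E p) {G. a \<le> (\<Sum>e\<in>E. c e * of_bool (G e))}
      \<le> Mean (bits E p) (\<lambda>G. exp ((\<Sum>e\<in>E. c e * of_bool (G e)) - a))"
    by (intro prob_le_expectation finite_set_bits E) auto
  also have "\<dots> = Mean (bits E p) (\<lambda>G. \<Prod>e\<in>E. exp (c e * of_bool (G e))) * exp (- a)"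
    using E by (simp add: exp_diff exp_sum exp_minus divide_inverse del: sum_mult_of_bool_eq)
  also have "Mean (bits E p) (\<lambda>G. \<Prod>e\<in>E. exp (c e * of_bool (G e)))
      = (\<Prod>e\<in>E. Mean (bernoulli_pmf p) (\<lambda>b. exp (c e * of_bool b)))"
    using E by (intro expectation_prod_Pi_pmf integrable_finite_set_pmf) auto
  also have "\<dots> \<le> (\<Prod>e\<in>E. exp (p * (exp (c e) - 1)))"
  proof (rule prod_mono)
    fix e
    have "Mean (bernoulli_pmf p) (\<lambda>b. exp (c e * of_bool b)) = 1 + p * (exp (c e) - 1)"
      using p by (simp add: algebra_simps)
    moreover have "0 \<le> Mean (bernoulli_pmf p) (\<lambda>b. exp (c e * of_bool b))"
      by (rule integral_nonneg_AE) auto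
    ultimately show "0 \<le> Mean (bernoulli_pmf p) (\<lambda>b. exp (c e * of_bool b))
        \<and> Mean (bernoulli_pmf p) (\<lambda>b. exp (c e * of_bool b)) \<le> exp (p * (exp (c e) - 1))"
      using exp_ge_add_one_self[of "p * (exp (c e) - 1)"] by simp
  qed
  also have "\<dots> = exp (p * (\<Sum>e\<in>E. exp (c e) - 1))"
    using E by (simp add: exp_sum sum_distrib_left)
  finally show ?thesis
    by (simp add: exp_diff exp_minus divide_inverse)
qed

definition ones :: "'e set \<Rightarrow> ('e \<Rightarrow> bool) \<Rightarrow> int" where
  "ones F G = (\<Sum>e\<in>F. of_bool (G e))"

lemma depends_on_ones: "depends_on (\<lambda>G. h (ones F G)) F"
  by (auto simp: depends_on_def ones_def intro!: arg_cong[where f=h] sum.cong)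

lemma ones_nonneg: "0 \<le> ones F G"
  by (simp add: ones_def sum_nonneg)

text \<open>Lower tail from the Chernoff bound with coefficient -1 on \<open>F\<close> and 0
  elsewhere; the factor 1/2 comes from exp (-1) - 1 \<le> -1/2.\<close>

lemma prob_ones_le:
  assumes E: "finite E" "F \<subseteq> E" and p: "0 \<le> p" "p \<le> 1"
  shows "Pr (bits E p) {G. of_int (ones F G) \<le> a} \<le> exp (a - p * card F / 2)"
proof -
  let ?c = "\<lambda>e. if e \<in> F then -1 else 0 :: real"
  have "real_of_int (ones F G) = (\<Sum>e\<in>F. of_bool (G e))" for G
    by (simp add: ones_def of_bool_def if_distrib cong: if_cong)
  also have "\<dots> G = (\<Sum>e\<in>E. - (?c e * of_bool (G e)))" for G
    using E by (intro sum.mono_neutral_cong_left) auto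
  finally have "{G. of_int (ones F G) \<le> a} = {G. - a \<le> (\<Sum>e\<in>E. ?c e * of_bool (G e))}"
    by (auto simp: sum_negf)
  then have "Pr (bits E p) {G. of_int (ones F G) \<le> a} \<le> exp (p * (\<Sum>e\<in>E. exp (?c e) - 1) - - a)"
    using Chernoff_bits[of E p "-a" ?c] E p by simp
  also have "(\<Sum>e\<in>E. exp (?c e) - 1) = (\<Sum>e\<in>F. exp (-1) - 1)"
    using E by (intro sum.mono_neutral_cong_right) auto
  also have "exp (-1::real) \<le> 1/2"
    using exp_ge_add_one_self[of "1::real"] by (simp add: exp_minus field_simps)
  then have "p * (\<Sum>e\<in>F. exp (-1) - 1) - - a \<le> a - p * card F / 2"
    using p mult_left_mono[of "card F * (exp (-1) - 1)" "card F * (- 1 / 2)" p] mult_left_mono[of "exp (-1) - 1" "-1/2" "card F"]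
    by (simp add: algebra_simps)
  finally show ?thesis by simp
qed

section \<open>Symmetric unimodal distributions\<close>

locale sym_unimodal =
  fixes Z :: "int pmf"
  assumes finite_supp: "finite (set_pmf Z)"
    and sym: "pmf Z (- k) = pmf Z k"
    and unimodal: "0 \<le> k \<Longrightarrow> pmf Z (k + 1) \<le> pmf Z k"
begin

lemma antimono: "i \<le> j \<Longrightarrow> 0 \<le> i \<Longrightarrow> pmf Z j \<le> pmf Z i"
proof (induction j rule: int_ge_induct)
  case (step j)
  then show ?case using unimodal[of j] by simp
qed simp

lemma pmf_abs: "pmf Z \<bar>k\<bar> = pmf Z k"
  using sym[of k] by (cases "k \<ge> 0") auto

text \<open>By symmetry the two tails have equal mass and share what the ball leaves over.\<close>

lemma prob_atMost_uminus:
  assumes "0 < d"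
  shows "Pr Z {.. - d} = (1 - Pr Z {- d <..< d}) / 2"
proof -
  have "map_pmf uminus Z = Z"
  proof (rule pmf_eqI)
    fix k
    show "pmf (map_pmf uminus Z) k = pmf Z k"
      using pmf_map_inj'[of uminus Z "-k"] sym[of k] by (simp add: inj_def)
  qed
  then have "Pr Z {d..} = Pr (map_pmf uminus Z) {d..}" by simp
  also have "\<dots> = Pr Z {.. - d}"
    by (auto intro!: arg_cong[where f="Pr Z"])
  finally have eq: "Pr Z {d..} = Pr Z {.. - d}" .
  have "1 = Pr Z ({.. - d} \<union> {- d <..< d} \<union> {d..})"
  proof -
    have "{.. - d} \<union> {- d <..< d} \<union> {d..} = UNIV" by auto
    then show ?thesis by simp
  qed
  also have "\<dots> = Pr Z ({.. - d} \<union> {- d <..< d}) + Pr Z {d..}"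
    using assms by (intro measure_pmf.finite_measure_Union) auto
  also have "Pr Z ({.. - d} \<union> {- d <..< d}) = Pr Z {.. - d} + Pr Z {- d <..< d}"
    using assms by (intro measure_pmf.finite_measure_Union) auto
  finally show ?thesis using eq by simp
qed

text \<open>The mass is (1 - f 0) / 2 + f 0 + f 1 with f the mass function, and f 1 \<le> f 0. This
  is the fallback bound when the positive surplus happens to be small.\<close>

lemma prob_atMost_1: "Pr Z {..1} \<le> 1 / 2 + 3 / 2 * pmf Z 0"
proof -
  have "{..1::int} = {.. - 1} \<union> {0, 1}" by auto
  then have "Pr Z {..1} = Pr Z {.. - 1} + Pr Z {0, 1}"
    by (simp only:) (intro measure_pmf.finite_measure_Union, auto)
  also have "Pr Z {0, 1} = pmf Z 0 + pmf Z 1"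
    by (simp add: measure_measure_pmf_finite)
  also have "Pr Z {.. - 1} = (1 - pmf Z 0) / 2"
  proof -
    have "{- 1 <..< 1::int} = {0}" by auto
    then show ?thesis using prob_atMost_uminus[of 1] by (simp add: measure_pmf_single)
  qed
  finally show ?thesis using unimodal[of 0] by (simp add: field_simps)
qed

text \<open>Each of the \<open>d\<close> points 0, ..., d - 1 of the ball has at least the mass of
  the more distant point \<open>k\<close>.\<close>

lemma pmf_le_prob_ball:
  assumes "0 < d" "d \<le> \<bar>k\<bar>"
  shows "of_int d * pmf Z k \<le> Pr Z {- d <..< d}"
proof -
  have "of_int d * pmf Z k = (\<Sum>j\<in>{0..<d}. pmf Z k)"
    using assms by simp
  also have "\<dots> \<le> (\<Sum>j\<in>{0..<d}. pmf Z j)"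
    using assms antimono[of _ "\<bar>k\<bar>"] by (intro sum_mono) (auto simp: pmf_abs)
  also have "\<dots> = Pr Z {0..<d}"
    by (simp add: measure_measure_pmf_finite)
  also have "\<dots> \<le> Pr Z {- d <..< d}"
    using assms by (intro measure_pmf.finite_measure_mono) auto
  finally show ?thesis .
qed

lemma pmf_0_le_prob_ball: "0 < d \<Longrightarrow> pmf Z 0 \<le> Pr Z {- d <..< d}"
  using measure_pmf.finite_measure_mono[of "{0}" "{- d <..< d}" Z] by (simp add: measure_pmf_single)

text \<open>By Chebyshev at least 3/4 of the mass lies within 2 s of 0. The at most 5 s integers
  there outside the ball each have mass at most 1/d of the mass of the ball, so the ball cannot be
  too light.\<close>

lemma prob_ball_ge:
  assumes s: "1 \<le> s" and var: "Mean Z (\<lambda>k. (of_int k)\<^sup>2) \<le> s\<^sup>2" and d: "0 < d" "of_int d \<le> s"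
  shows "of_int d / (8 * s) \<le> Pr Z {- d <..< d}"
proof -
  let ?\<pi> = "Pr Z {- d <..< d}" and ?K = "{k. d \<le> \<bar>k\<bar> \<and> \<bar>k\<bar> \<le> \<lfloor>2 * s\<rfloor>}"
  have sub: "?K \<subseteq> {- \<lfloor>2 * s\<rfloor>..\<lfloor>2 * s\<rfloor>}" by auto
  then have finK: "finite ?K"
    by (rule finite_subset) simp
  have "card ?K \<le> card {- \<lfloor>2 * s\<rfloor>..\<lfloor>2 * s\<rfloor>}"
    by (intro card_mono sub) simp
  \<comment> \<open>At most 4 s + 1 integers have absolute value at most 2 s, and 1 \<le> s.\<close>
  then have cK: "real (card ?K) \<le> 5 * s"
    using s by (simp add: nat_le_iff) linarith
  have far: "Pr Z {k. 2 * s \<le> \<bar>of_int k\<bar>} \<le> 1 / 4"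
  proof -
    have "Pr Z {k. 2 * s \<le> \<bar>of_int k\<bar>} \<le> Mean Z (\<lambda>k. (of_int k)\<^sup>2) / (2 * s)\<^sup>2"
      using Chebyshev_prob[OF finite_supp, of "2 * s" of_int] s by simp
    also have "\<dots> \<le> s\<^sup>2 / (2 * s)\<^sup>2"
      using var by (intro divide_right_mono) auto
    also have "\<dots> = 1 / 4" using s by (simp add: power2_eq_square)
    finally show ?thesis .
  qed
  have "1 = Pr Z UNIV" by simp
  also have "\<dots> \<le> Pr Z (({- d <..< d} \<union> ?K) \<union> {k. 2 * s \<le> \<bar>of_int k\<bar>})"
    by (intro measure_pmf.finite_measure_mono) (auto, linarith+)
  also have "\<dots> \<le> Pr Z ({- d <..< d} \<union> ?K) + Pr Z {k. 2 * s \<le> \<bar>of_int k\<bar>}"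
    by (rule measure_Un_le) auto
  also have "Pr Z ({- d <..< d} \<union> ?K) \<le> ?\<pi> + Pr Z ?K"
    by (rule measure_Un_le) auto
  also have "Pr Z ?K = (\<Sum>k\<in>?K. pmf Z k)"
    using finK by (rule measure_measure_pmf_finite)
  also have "\<dots> \<le> (\<Sum>k\<in>?K. ?\<pi> / of_int d)"
    using pmf_le_prob_ball[OF d(1)] d by (intro sum_mono) (auto simp: field_simps)
  also have "\<dots> = real (card ?K) * (?\<pi> / of_int d)" by simp
  also have "\<dots> \<le> 5 * s * (?\<pi> / of_int d)"
    using cK d by (intro mult_right_mono) auto
  finally have "3 / 4 \<le> ?\<pi> + 5 * s * (?\<pi> / of_int d)"
    using far by simp
  then have "3 / 4 * of_int d \<le> ?\<pi> * (of_int d + 5 * s)"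
    using d by (simp add: field_simps)
  also have "\<dots> \<le> ?\<pi> * (6 * s)"
    using d by (intro mult_left_mono) auto
  finally show ?thesis using s by (simp add: field_simps)
qed

end

section \<open>Bias of a sum of signed bits\<close>

text \<open>For disjoint \<open>A\<close>, \<open>B\<close> of equal size this is a lazy symmetric
  random walk, one step for each matched pair of bits.\<close>

definition balance :: "'e set \<Rightarrow> 'e set \<Rightarrow> ('e \<Rightarrow> bool) \<Rightarrow> int" where
  "balance A B G = ones A G - ones B G"

lemma depends_on_balance: "depends_on (\<lambda>G. h (balance A B G)) (A \<union> B)"
  unfolding balance_def
  by (rule depends_on_comp2[where h="\<lambda>x y. h (x - y)"])
    (rule depends_on_mono[OF depends_on_ones[where h="\<lambda>x. x"]]; blast)+

lemma ones_insert: "finite A \<Longrightarrow> a \<notin> A \<Longrightarrow> ones (insert a A) G = of_bool (G a) + ones A G"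
  by (simp add: ones_def)

lemma balance_insert:
  assumes "finite A" "finite B" "a \<notin> A" "b \<notin> B"
  shows "balance (insert a A) (insert b B) G = balance A B G + of_bool (G a) - of_bool (G b)"
  using assms by (simp add: balance_def ones_insert)

context
  fixes E :: "'e set" and p :: real
  assumes E: "finite E" and p: "0 \<le> p" "p \<le> 1"
begin

lemma integrable_bits: "integrable (bits E p) (h :: _ \<Rightarrow> real)"
  using E by (intro integrable_finite_set_pmf finite_set_bits)

lemma expectation_two_bits:
  fixes h k :: "bool \<Rightarrow> real"
  assumes "a \<in> E" "b \<in> E" "a \<noteq> b"
  shows "Mean (bits E p) (\<lambda>G. h (G a) * k (G b)) = (p * h True + (1 - p) * h False) * (p * k True + (1 - p) * k False)"
  using expectation_indep[OF E depends_on_bit[of h a] depends_on_bit[of k b], of p] assms E p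
  by (simp add: expectation_bit)

text \<open>One new bit on each side convolves the law with a lazy step, equal to 1 and to -1 with
  probability p (1 - p) each.\<close>

lemma pmf_balance_insert:
  assumes sub: "insert a A \<subseteq> E" "insert b B \<subseteq> E"
    and dist: "a \<noteq> b" "a \<notin> A \<union> B" "b \<notin> A \<union> B"
  defines "f \<equiv> pmf (map_pmf (balance A B) (bits E p))"
  shows "pmf (map_pmf (balance (insert a A) (insert b B)) (bits E p)) k
    = p * (1 - p) * f (k - 1) + p * (1 - p) * f (k + 1) + (1 - 2 * (p * (1 - p))) * f k"
proof -
  have fin: "finite A" "finite B" using sub E finite_subset by auto
  have pm: "pmf (map_pmf g (bits E p)) k = Mean (bits E p) (\<lambda>G. of_bool (g G = k))"
    for g :: "('e \<Rightarrow> bool) \<Rightarrow> int" and k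
  proof -
    have "g -` {k} = {G. g G = k}" by auto
    then show ?thesis by (simp add: pmf_map prob_eq_expectation)
  qed
  have ind: "Mean (bits E p) (\<lambda>G. of_bool (balance A B G = j) * (h (G a) * l (G b)))
      = f j * ((p * h True + (1 - p) * h False) * (p * l True + (1 - p) * l False))"
    for j and h l :: "bool \<Rightarrow> real"
  proof -
    have d: "depends_on (\<lambda>G. h (G a) * l (G b)) {a, b}"
      by (rule depends_on_comp2[where h="(*)"]) (auto simp: depends_on_def)
    show ?thesis
      using expectation_indep[OF E depends_on_balance[of "\<lambda>x. of_bool (x = j)" A B] d, of p] dist sub
      by (simp add: expectation_two_bits f_def pm)
  qed
  let ?Z = "\<lambda>j G. of_bool (balance A B G = j) :: real" and ?x = "of_bool :: bool \<Rightarrow> real" and ?y = "\<lambda>b. of_bool (\<not> b) :: real"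
  have "(\<lambda>G. of_bool (balance (insert a A) (insert b B) G = k))
     = (\<lambda>G. ?Z (k - 1) G * (?x (G a) * ?y (G b)) + ?Z (k + 1) G * (?y (G a) * ?x (G b))
         + ?Z k G * (?x (G a) * ?x (G b)) + ?Z k G * (?y (G a) * ?y (G b)))"
    using fin dist by (intro ext) (auto simp: balance_insert)
  then have "pmf (map_pmf (balance (insert a A) (insert b B)) (bits E p)) k
    = f (k - 1) * (p * (1 - p)) + f (k + 1) * ((1 - p) * p) + f k * (p * p) + f k * ((1 - p) * (1 - p))"
    by (simp only: pm Bochner_Integration.integral_add[OF integrable_bits integrable_bits]
        ind[of _ ?x ?y] ind[of _ ?y ?x] ind[of _ ?x ?x] ind[of _ ?y ?y]) simp
  also have "\<dots> = p * (1 - p) * f (k - 1) + p * (1 - p) * f (k + 1) + (1 - 2 * (p * (1 - p))) * f k"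
    by algebra
  finally show ?thesis .
qed

text \<open>The new step is centred and independent of the old balance, so the cross term vanishes;
  its square is at most the sum of the two new bits, of mean 2 p.\<close>

lemma expectation_balance_insert_sq:
  assumes sub: "insert a A \<subseteq> E" "insert b B \<subseteq> E"
    and dist: "a \<noteq> b" "a \<notin> A \<union> B" "b \<notin> A \<union> B"
  shows "Mean (bits E p) (\<lambda>G. (of_int (balance (insert a A) (insert b B) G))\<^sup>2)
    \<le> Mean (bits E p) (\<lambda>G. (of_int (balance A B G))\<^sup>2) + 2 * p"
proof -
  have fin: "finite A" "finite B" using sub E finite_subset by auto
  let ?Z = "\<lambda>G. of_int (balance A B G) :: real" and ?D = "\<lambda>G. of_bool (G a) - of_bool (G b) :: real"
  have D: "Mean (bits E p) (\<lambda>G. of_bool (G e)) = p" if "e \<in> E" for e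
    using expectation_bit[OF E that p, of of_bool] by simp
  have d: "depends_on ?D {a, b}"
    by (auto simp: depends_on_def)
  have "Mean (bits E p) (\<lambda>G. ?Z G * ?D G) = Mean (bits E p) ?Z * Mean (bits E p) ?D"
    using dist by (intro expectation_indep[OF E depends_on_balance d]) auto
  also have "Mean (bits E p) ?D = 0"
    using sub by (simp add: integrable_bits D)
  finally have ZD: "Mean (bits E p) (\<lambda>G. ?Z G * ?D G) = 0" by simp
  have "Mean (bits E p) (\<lambda>G. (of_int (balance (insert a A) (insert b B) G))\<^sup>2)
     \<le> Mean (bits E p) (\<lambda>G. (?Z G)\<^sup>2 + 2 * (?Z G * ?D G) + (of_bool (G a) + of_bool (G b)))"
    using fin dist
    by (intro integral_mono integrable_bits) (auto simp: balance_insert power2_eq_square algebra_simps of_bool_def)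
  also have "\<dots> = Mean (bits E p) (\<lambda>G. (?Z G)\<^sup>2) + 2 * Mean (bits E p) (\<lambda>G. ?Z G * ?D G)
      + (Mean (bits E p) (\<lambda>G. of_bool (G a)) + Mean (bits E p) (\<lambda>G. of_bool (G b)))"
    by (simp only: Bochner_Integration.integral_add[OF integrable_bits integrable_bits] integral_mult_right_zero)
  also have "\<dots> = Mean (bits E p) (\<lambda>G. (?Z G)\<^sup>2) + 2 * p"
    using sub by (simp only: ZD) (simp add: D)
  finally show ?thesis .
qed

text \<open>Induction over matched pairs: convolution with a lazy step preserves symmetry and
  unimodality and adds at most 2 p to the second moment.\<close>

lemma balance_sym_unimodal:
  assumes "A \<subseteq> E" "B \<subseteq> E" "A \<inter> B = {}" "card A = card B"
  shows "sym_unimodal (map_pmf (balance A B) (bits E p))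
    \<and> Mean (bits E p) (\<lambda>G. (of_int (balance A B G))\<^sup>2) \<le> 2 * p * card A"
proof -
  have "finite A" using assms(1) E finite_subset by auto
  then show ?thesis using assms
  proof (induction A arbitrary: B rule: finite_induct)
    case empty
    then have B: "B = {}" using E finite_subset by (metis card_0_eq card.empty)
    then have "map_pmf (balance {} B) (bits E p) = map_pmf (\<lambda>_. 0) (bits E p)"
      by (intro map_pmf_cong) (auto simp: balance_def)
    then have "map_pmf (balance {} B) (bits E p) = return_pmf 0" by simp
    then show ?case using B
      by (auto simp: sym_unimodal_def balance_def indicator_def)
  next
    case (insert a A B')
    have finB: "finite B'" using insert.prems E finite_subset by auto
    then have "B' \<noteq> {}" using insert by auto
    then obtain b where b: "b \<in> B'" by blast
    define B where "B = B' - {b}"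
    have B': "B' = insert b B" "b \<notin> B" using b by (auto simp: B_def)
    have IH: "sym_unimodal (map_pmf (balance A B) (bits E p))"
      "Mean (bits E p) (\<lambda>G. (of_int (balance A B G))\<^sup>2) \<le> 2 * p * card A"
      using insert.IH[of B] insert.prems insert.hyps finB B' by auto
    interpret f: sym_unimodal "map_pmf (balance A B) (bits E p)" by (fact IH)
    let ?f = "pmf (map_pmf (balance A B) (bits E p))"
      and ?g = "pmf (map_pmf (balance (insert a A) (insert b B)) (bits E p))"
    \<comment> \<open>The step is lazy enough because q \<le> 1/4; below, q \<le> 1/3 is what
      matters.\<close>
    define q where "q = p * (1 - p)"
    have q: "0 \<le> q" "q \<le> 1 / 4"
      using p zero_le_square[of "2 * p - 1"] by (simp add: q_def, simp add: q_def algebra_simps)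
    have sides: "insert a A \<subseteq> E" "insert b B \<subseteq> E" "a \<noteq> b" "a \<notin> A \<union> B" "b \<notin> A \<union> B"
      using insert B' by auto
    have rec: "?g k = q * ?f (k - 1) + q * ?f (k + 1) + (1 - 2 * q) * ?f k" for k
      unfolding q_def by (rule pmf_balance_insert[OF sides])
    have "sym_unimodal (map_pmf (balance (insert a A) (insert b B)) (bits E p))"
    proof
      show "finite (set_pmf (map_pmf (balance (insert a A) (insert b B)) (bits E p)))"
        using E by (simp add: finite_set_bits)
      show "?g (- k) = ?g k" for k
        using f.sym[of k] f.sym[of "k + 1"] f.sym[of "k - 1"] by (simp add: rec)
      show "?g (k + 1) \<le> ?g k" if "0 \<le> k" for k
      proof -
        have "?g k - ?g (k + 1) = q * (?f (k - 1) - ?f k) + q * (?f (k + 1) - ?f (k + 2))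
            + (1 - 2 * q) * (?f k - ?f (k + 1))"
          by (simp add: rec algebra_simps)
        moreover have "0 \<le> q * (?f (k + 1) - ?f (k + 2))"
          using q f.unimodal[of "k + 1"] that by (simp add: add.assoc)
        moreover have "0 \<le> q * (?f (k - 1) - ?f k) + (1 - 2 * q) * (?f k - ?f (k + 1))"
        proof (cases "k = 0")
          \<comment> \<open>At 0 the difference f (-1) - f 0 has the wrong sign, but by symmetry it
            equals f 1 - f 0, and the two terms combine to (1 - 3 q) (f 0 - f 1).\<close>
          case True
          have "0 \<le> (1 - 3 * q) * (?f 0 - ?f 1)"
            using q f.unimodal[of 0] by (intro mult_nonneg_nonneg) auto
          then show ?thesis using True f.sym[of 1] by (simp add: algebra_simps)
        next
          case False
          then show ?thesis
            using q f.unimodal[of "k - 1"] f.unimodal[of k] that by (intro add_nonneg_nonneg mult_nonneg_nonneg) auto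
        qed
        ultimately show ?thesis by linarith
      qed
    qed
    moreover have "Mean (bits E p) (\<lambda>G. (of_int (balance (insert a A) (insert b B) G))\<^sup>2) \<le> 2 * p * card (insert a A)"
      using expectation_balance_insert_sq[OF sides] IH(2) insert.hyps by (simp add: algebra_simps)
    ultimately show ?case using B' by simp
  qed
qed

text \<open>Let Z be the balance of \<open>A\<close> and \<open>B\<close>, and D the number of ones
  in \<open>C\<close>. If D > d, then Z + D \<le> 1 forces Z \<le> -d, which saves half the mass
  \<pi> of the ball of radius d. If D \<le> d, at most 3/2 \<pi> is lost, but this has probability
  at most 1/8. The net gain is at least \<pi> / 4.\<close>

lemma prob_signed_sum_le_1:
  fixes n :: nat and x :: real
  assumes sub: "A \<subseteq> E" "B \<subseteq> E" "C \<subseteq> E" and disj: "A \<inter> B = {}" "(A \<union> B) \<inter> C = {}"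
    and card: "card A = card B" "2 * card A \<le> n"
    and x: "20 \<le> x" "x \<le> sqrt (p * n)" "x / 2 \<le> p * card C"
  shows "Pr (bits E p) {G. ones A G + ones C G - ones B G \<le> 1} \<le> 1 / 2 - x / (640 * sqrt (p * n))"
proof -
  let ?Z = "map_pmf (balance A B) (bits E p)"
  interpret Z: sym_unimodal ?Z
    using balance_sym_unimodal[OF sub(1,2) disj(1) card(1)] by simp
  define s where "s = sqrt (p * n)"
  \<comment> \<open>As 20 \<le> x, rounding costs at most half of x / 10. Still d is small against
    the mean p |C| \<ge> x / 2 of D: the lower tail exponent d - p |C| / 2 is at most -3 x / 20
    \<le> -3.\<close>
  define d where "d = \<lfloor>x / 10\<rfloor>"
  define \<pi> where "\<pi> = Pr ?Z {- d <..< d}"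
  have d: "0 < d" "x / 20 \<le> of_int d" "of_int d \<le> x / 10"
    using x unfolding d_def by linarith+
  have prZ: "Pr ?Z {..j} = Mean (bits E p) (\<lambda>G. of_bool (balance A B G \<le> j))" for j
  proof -
    have "balance A B -` {..j} = {G. balance A B G \<le> j}" by auto
    then show ?thesis by (simp add: prob_eq_expectation)
  qed
  have indep: "Mean (bits E p) (\<lambda>G. of_bool (P (ones C G)) * of_bool (balance A B G \<le> j))
      = Pr (bits E p) {G. P (ones C G)} * Pr ?Z {..j}" for P j
    unfolding prZ prob_eq_expectation
    using disj by (intro expectation_indep[OF E depends_on_ones[where h="\<lambda>x. of_bool (P x)"] depends_on_balance[where h="\<lambda>x. of_bool (x \<le> j)"]]) auto
  define \<rho> where "\<rho> = Pr (bits E p) {G. ones C G \<le> d}"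
  have \<rho>c: "Pr (bits E p) {G. d < ones C G} = 1 - \<rho>"
  proof -
    have "{G. d < ones C G} = - {G. ones C G \<le> d}" by auto
    then show ?thesis
      unfolding \<rho>_def using measure_pmf.prob_compl[of "{G. ones C G \<le> d}" "bits E p"] by (simp add: Compl_eq_Diff_UNIV)
  qed
  have \<rho>: "\<rho> \<le> 1 / 8"
  proof -
    have "\<rho> \<le> exp (of_int d - p * card C / 2)"
      using prob_ones_le[OF E sub(3) p, of "of_int d"] by (simp add: \<rho>_def)
    also have "\<dots> \<le> exp (-3)"
      using d x by simp
    also have "exp (-3::real) = exp (-1) ^ 3"
      by (simp add: exp_of_nat_mult[symmetric])
    also have "\<dots> \<le> (1/2) ^ 3"
      using exp_ge_add_one_self[of "1::real"] by (intro power_mono) (auto simp: exp_minus field_simps)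
    finally show ?thesis by (simp add: power3_eq_cube)
  qed
  have \<rho>0: "0 \<le> \<rho>" and \<pi>0: "0 \<le> \<pi>" by (simp_all add: \<rho>_def \<pi>_def)
  have s: "1 \<le> s" using x unfolding s_def by linarith
  have \<pi>: "x / (160 * s) \<le> \<pi>"
  proof -
    have "2 * p * card A \<le> p * n"
      using card(2) p by (metis mult.assoc mult.commute mult_left_mono of_nat_le_iff of_nat_mult of_nat_numeral)
    also have "\<dots> = s\<^sup>2" using p by (simp add: s_def)
    finally have "Mean ?Z (\<lambda>k. (of_int k)\<^sup>2) \<le> s\<^sup>2"
      using balance_sym_unimodal[OF sub(1,2) disj(1) card(1)] by simp
    then have "of_int d / (8 * s) \<le> \<pi>"
      unfolding \<pi>_def using d s x by (intro Z.prob_ball_ge) (auto simp: s_def)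
    moreover have "x / (160 * s) \<le> of_int d / (8 * s)"
      using d s by (simp add: field_simps)
    ultimately show ?thesis by simp
  qed
  have "Pr (bits E p) {G. ones A G + ones C G - ones B G \<le> 1}
      \<le> Mean (bits E p) (\<lambda>G. of_bool (d < ones C G) * of_bool (balance A B G \<le> - d)
          + of_bool (ones C G \<le> d) * of_bool (balance A B G \<le> 1))"
  proof (rule prob_le_expectation[OF finite_set_bits[OF E]])
    fix G assume "ones A G + ones C G - ones B G \<le> 1"
    then show "1 \<le> of_bool (d < ones C G) * of_bool (balance A B G \<le> - d)
          + (of_bool (ones C G \<le> d) * of_bool (balance A B G \<le> 1) :: real)"
      using ones_nonneg[of C G] by (cases "d < ones C G") (auto simp: balance_def)
  qed auto
  also have "\<dots> = (1 - \<rho>) * Pr ?Z {.. - d} + \<rho> * Pr ?Z {..1}"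
    by (simp only: Bochner_Integration.integral_add[OF integrable_bits integrable_bits] 
        indep[of "\<lambda>k. d < k"] indep[of "\<lambda>k. k \<le> d"] \<rho>c \<rho>_def[symmetric])
  \<comment> \<open>The loss 3/2 \<open>pmf Z 0\<close> is replaced by 3/2 \<pi>, so that gain and
    loss are measured by the same quantity.\<close>
  also have "\<dots> \<le> (1 - \<rho>) * ((1 - \<pi>) / 2) + \<rho> * (1 / 2 + 3 / 2 * \<pi>)"
    using \<rho> \<rho>0 Z.prob_atMost_uminus[OF d(1)] Z.prob_atMost_1 Z.pmf_0_le_prob_ball[OF d(1)]
    by (intro add_mono mult_left_mono) (auto simp: \<pi>_def)
  also have "\<dots> = 1 / 2 - \<pi> / 2 + 2 * (\<rho> * \<pi>)"
    by (simp add: field_simps)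
  also have "\<dots> \<le> 1 / 2 - \<pi> / 2 + 2 * (1 / 8 * \<pi>)"
    using \<rho> \<pi>0 by (intro add_left_mono mult_left_mono mult_right_mono) auto
  also have "\<dots> \<le> 1 / 2 - x / (640 * s)"
    using \<pi> by (simp add: field_simps)
  finally show ?thesis by (simp add: s_def)
qed

end

section \<open>The first two rounds\<close>

lemma finite_vertices [simp]: "finite (vertices n)" and card_vertices [simp]: "card (vertices n) = n"
  by (simp_all add: vertices_def)

lemma finite_pairs: "finite (pairs n)"
proof -
  have "pairs n \<subseteq> Pow (vertices n)" by (auto simp: pairs_def)
  then show ?thesis by (rule finite_subset) simp
qed

lemma pair_in_pairs: "u \<in> vertices n \<Longrightarrow> v \<in> vertices n \<Longrightarrow> u \<noteq> v \<Longrightarrow> {u, v} \<in> pairs n"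
  by (auto simp: pairs_def)

lemma nbhd_sum:
  "(\<Sum>u\<in>nbhd n G v. f u) = (\<Sum>u\<in>vertices n - {v}. of_bool (G {u, v}) * (f u :: 'a :: comm_ring_1))"
proof -
  have "nbhd n G v = (vertices n - {v}) \<inter> {u. G {u, v}}" by (auto simp: nbhd_def)
  then show ?thesis by (simp add: sum.inter_restrict)
qed

definition star :: "nat \<Rightarrow> nat set \<Rightarrow> nat set set" where
  "star u W = (\<lambda>w. {u, w}) ` W"

lemma inj_on_star: "inj_on (\<lambda>w. {u, w}) W"
  by (auto simp: inj_on_def doubleton_eq_iff)

lemma card_star: "card (star u W) = card W"
  unfolding star_def by (rule card_image[OF inj_on_star])

lemma ones_star: "ones (star u W) G = (\<Sum>w\<in>W. of_bool (G {u, w}))"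
  unfolding ones_def star_def by (simp add: sum.reindex[OF inj_on_star])

lemma star_subset_pairs: "u \<in> vertices n \<Longrightarrow> W \<subseteq> vertices n - {u} \<Longrightarrow> star u W \<subseteq> pairs n"
  unfolding star_def by (auto intro!: pair_in_pairs)

text \<open>The initial state is fixed here and only the graph is random; averaging over initial
  states comes at the end.\<close>

locale dynamics =
  fixes n :: nat and p :: real and S :: "nat \<Rightarrow> int"
  assumes p: "0 \<le> p" "p \<le> 1" and S: "u \<in> vertices n \<Longrightarrow> S u = 1 \<or> S u = -1"
begin

abbreviation "V \<equiv> vertices n"
abbreviation "M \<equiv> bits (pairs n) p"

lemma integrable_M: "integrable M (h :: _ \<Rightarrow> real)"
  by (rule integrable_bits[OF finite_pairs p])

text \<open>The state of a neighbour \<open>u\<close> of \<open>v\<close> after one round, as a function that does not look at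
  the edges at \<open>v\<close>.\<close>

definition T :: "nat \<Rightarrow> nat \<Rightarrow> (nat set \<Rightarrow> bool) \<Rightarrow> int" where
  "T v u G = (let s = S v + (\<Sum>w\<in>V - {u, v}. of_bool (G {u, w}) * S w) in if s \<noteq> 0 then sgn s else S u)"

text \<open>Once the edge \<open>{u, v}\<close> is present, \<open>v\<close> contributes exactly
  \<open>S v\<close> to the sum at \<open>u\<close>, which is the constant built into
  \<open>T\<close>.\<close>

lemma maj_step_eq_T:
  assumes "u \<in> V" "v \<in> V" "u \<noteq> v" "G {u, v}"
  shows "maj_step n G S u = T v u G"
proof -
  have "(\<Sum>w\<in>nbhd n G u. S w) = (\<Sum>w\<in>V - {u}. of_bool (G {u, w}) * S w)"
    by (simp add: nbhd_sum insert_commute)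
  also have "\<dots> = S v + (\<Sum>w\<in>V - {u} - {v}. of_bool (G {u, w}) * S w)"
    using assms by (subst sum.remove[of _ v]) auto
  also have "V - {u} - {v} = V - {u, v}" by auto
  finally show ?thesis
    by (simp add: maj_step_def T_def Let_def)
qed

lemma second_round_sum:
  assumes "v \<in> V"
  shows "(\<Sum>u\<in>nbhd n G v. maj_step n G S u) = (\<Sum>u\<in>V - {v}. of_bool (G {u, v}) * T v u G)"
  unfolding nbhd_sum using assms maj_step_eq_T by (intro sum.cong) auto

lemma T_sq: "u \<in> V \<Longrightarrow> (T v u G)\<^sup>2 = 1"
  using S[of u] by (auto simp: T_def Let_def sgn_if)

lemma depends_on_T: "depends_on (\<lambda>G. h (T v u G)) (star u (V - {u, v}))"
proof -
  have "T v u G = T v u H" if "\<forall>e\<in>star u (V - {u, v}). G e = H e" for G H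
  proof -
    have "(\<Sum>w\<in>V - {u, v}. of_bool (G {u, w}) * S w) = (\<Sum>w\<in>V - {u, v}. of_bool (H {u, w}) * S w)"
      using that by (intro sum.cong) (auto simp: star_def)
    then show ?thesis by (simp add: T_def)
  qed
  then show ?thesis unfolding depends_on_def by metis
qed

text \<open>The negative vertices \<open>Wm\<close> are matched with equally many positive ones
  \<open>W1\<close>, giving the symmetric part; the remaining positive vertices \<open>W2\<close>
  give the surplus. The bias of this signed sum is twice x / (640 sqrt (p n)) with x = c p sqrt n,
  that is c sqrt p / 320.\<close>

lemma expectation_T_ge:
  assumes uv: "u \<in> V" "v \<in> V" "u \<noteq> v"
    and c: "0 \<le> c" "c \<le> 1" "c * sqrt n \<le> of_int (\<Sum>w\<in>V. S w)" and x: "20 \<le> c * p * sqrt n"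
  shows "c * sqrt p / 320 \<le> Mean M (\<lambda>G. of_int (T v u G))"
proof -
  define W where "W = V - {u, v}"
  define Wp where "Wp = {w\<in>W. S w = 1}"
  define Wm where "Wm = {w\<in>W. S w = -1}"
  have fin: "finite W" "finite Wp" "finite Wm" by (auto simp: W_def Wp_def Wm_def)
  have W: "W = Wp \<union> Wm" "Wp \<inter> Wm = {}"
    using S by (auto simp: W_def Wp_def Wm_def)
  have sums: "(\<Sum>w\<in>W. h w * S w) = (\<Sum>w\<in>Wp. h w) - (\<Sum>w\<in>Wm. h w)" for h
  proof -
    have "(\<Sum>w\<in>W. h w * S w) = (\<Sum>w\<in>Wp. h w * S w) + (\<Sum>w\<in>Wm. h w * S w)"
      unfolding W(1) using fin W(2) by (intro sum.union_disjoint) auto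
    also have "(\<Sum>w\<in>Wp. h w * S w) = (\<Sum>w\<in>Wp. h w)" by (intro sum.cong) (auto simp: Wp_def)
    also have "(\<Sum>w\<in>Wm. h w * S w) = (\<Sum>w\<in>Wm. - h w)" by (intro sum.cong) (auto simp: Wm_def)
    finally show ?thesis by (simp add: sum_negf)
  qed
  have "(\<Sum>w\<in>V. S w) = S u + (S v + (\<Sum>w\<in>V - {u} - {v}. S w))"
    using uv by (subst sum.remove[of V u], simp, simp, subst sum.remove[of _ v]) auto
  also have "V - {u} - {v} = W" by (auto simp: W_def)
  also have "(\<Sum>w\<in>W. S w) = int (card Wp) - int (card Wm)"
    using sums[of "\<lambda>_. 1"] by simp
  finally have "(\<Sum>w\<in>V. S w) \<le> 2 + int (card Wp) - int (card Wm)"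
    using S[OF uv(1)] S[OF uv(2)] by auto
  \<comment> \<open>The 2 pays for \<open>u\<close> and \<open>v\<close>, which are left out of
    \<open>W\<close>.\<close>
  then have big: "c * sqrt n \<le> 2 + real (card Wp) - real (card Wm)"
    using c(3) by linarith
  have "c * p * sqrt n \<le> c * sqrt n"
    using c p mult_right_mono[of p 1 "c * sqrt n"] by (simp add: mult_ac)
  then have c20: "20 \<le> c * sqrt n" using x by linarith
  then have "card Wm \<le> card Wp" using big by linarith
  then obtain W1 where W1: "W1 \<subseteq> Wp" "card W1 = card Wm"
    using obtain_subset_with_card_n by metis
  define W2 where "W2 = Wp - W1"
  have finW1: "finite W1" using W1 fin finite_subset by auto
  have cW2: "c * sqrt n \<le> 2 + real (card W2)"
    using big W1 finW1 \<open>card Wm \<le> card Wp\<close> by (simp add: W2_def card_Diff_subset of_nat_diff)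
  have disj_star: "star u X \<inter> star u Y = {}" if "X \<inter> Y = {}" for X Y
    using that by (auto simp: star_def doubleton_eq_iff)
  have subW: "W1 \<subseteq> V - {u}" "W2 \<subseteq> V - {u}" "Wm \<subseteq> V - {u}"
    using W1 by (auto simp: W2_def Wp_def Wm_def W_def)
  have decomp: "(\<Sum>w\<in>W. of_bool (G {u, w}) * S w) = ones (star u W1) G + ones (star u W2) G - ones (star u Wm) G" for G
  proof -
    have "(\<Sum>w\<in>Wp. of_bool (G {u, w})) = (\<Sum>w\<in>W1. of_bool (G {u, w})) + (\<Sum>w\<in>W2. of_bool (G {u, w}) :: int)"
      using W1(1) fin unfolding W2_def by (subst sum.subset_diff[of W1 Wp]) (auto simp: add.commute)
    then show ?thesis by (simp only: sums ones_star)
  qed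
  let ?bad = "{G. ones (star u W1) G + ones (star u W2) G - ones (star u Wm) G \<le> 1}"
  have s: "c * p * sqrt n / (640 * sqrt (p * n)) = c * sqrt p / 640"
  proof -
    have "p = sqrt p * sqrt p" "0 < n" "0 < p" using p x by (auto intro: Nat.gr0I order.not_eq_order_implies_strict)
    then show ?thesis by (simp add: real_sqrt_mult field_simps)
  qed
  have "Pr M ?bad \<le> 1 / 2 - c * p * sqrt n / (640 * sqrt (p * n))"
  proof (rule prob_signed_sum_le_1[OF finite_pairs p])
    show "star u W1 \<subseteq> pairs n" "star u Wm \<subseteq> pairs n" "star u W2 \<subseteq> pairs n"
      using subW uv by (intro star_subset_pairs; simp)+
    show "star u W1 \<inter> star u Wm = {}"
      using W1 W by (intro disj_star) auto
    have "star u W1 \<union> star u Wm = star u (W1 \<union> Wm)" by (auto simp: star_def)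
    moreover have "star u (W1 \<union> Wm) \<inter> star u W2 = {}"
      using W by (intro disj_star) (auto simp: W2_def)
    ultimately show "(star u W1 \<union> star u Wm) \<inter> star u W2 = {}" by simp
    show "card (star u W1) = card (star u Wm)" using W1 by (simp add: card_star)
    have "card W1 + card Wm = card (W1 \<union> Wm)"
      using W1 W finW1 fin by (intro card_Un_disjoint[symmetric]) auto
    also have "\<dots> \<le> card V"
      using subW by (intro card_mono) auto
    finally show "2 * card (star u W1) \<le> n" using W1 by (simp add: card_star)
    show "20 \<le> c * p * sqrt n" by (fact x)
    have "p * p \<le> p" using p by (simp add: mult_left_le)
    then have "p \<le> sqrt p" using p by (intro real_le_rsqrt) (simp add: power2_eq_square)
    then have "c * p \<le> 1 * sqrt p" using c p by (intro mult_mono) auto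
    then show "c * p * sqrt n \<le> sqrt (p * n)"
      unfolding real_sqrt_mult by (intro mult_right_mono) auto
    \<comment> \<open>Since 20 \<le> c sqrt n, subtracting the 2 leaves more than half.\<close>
    have "c * sqrt n / 2 \<le> card W2" using cW2 c20 by linarith
    from mult_left_mono[OF this p(1)]
    show "c * p * sqrt n / 2 \<le> p * card (star u W2)"
      by (simp add: card_star mult_ac)
  qed
  then have bad: "Mean M (\<lambda>G. of_bool (ones (star u W1) G + ones (star u W2) G - ones (star u Wm) G \<le> 1)) \<le> 1 / 2 - c * sqrt p / 640"
    unfolding s prob_eq_expectation .
  have "1 - (2::real) * Mean M (\<lambda>G. of_bool (ones (star u W1) G + ones (star u W2) G - ones (star u Wm) G \<le> 1))
     = Mean M (\<lambda>G. 1 - 2 * of_bool (ones (star u W1) G + ones (star u W2) G - ones (star u Wm) G \<le> 1))"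
    by (simp add: integrable_M)
  also have "\<dots> \<le> Mean M (\<lambda>G. of_int (T v u G))"
  proof (intro integral_mono integrable_M)
    fix G
    \<comment> \<open>Off the bad event the sum over \<open>W\<close> is at least 2, so even
      \<open>S v = -1\<close> leaves it positive and \<open>T\<close> is 1; on the bad event
      \<open>T\<close> is at least -1.\<close>
    show "1 - 2 * of_bool (ones (star u W1) G + ones (star u W2) G - ones (star u Wm) G \<le> 1) \<le> real_of_int (T v u G)"
      unfolding decomp[symmetric] T_def W_def[symmetric] Let_def
      using S[OF uv(1)] S[OF uv(2)] by (auto simp: sgn_if)
  qed
  finally show ?thesis using bad by simp
qed

end

section \<open>Mean and variance of the neighbourhood sum after one round\<close>

context dynamics
begin

context
  fixes v assumes v: "v \<in> V"
begin

definition mean_T :: "nat \<Rightarrow> real" where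
  "mean_T u = Mean M (\<lambda>G. of_int (T v u G))"

text \<open>The term of the edge \<open>{u, u'}\<close> in Bessel's inequality for the state of
  \<open>u\<close>; not symmetric in general, and 0 on the diagonal so that sums may run over all
  pairs.\<close>

definition edge_weight :: "nat \<Rightarrow> nat \<Rightarrow> real" where
  "edge_weight u u' = (if u = u' then 0 else p * (1 - p) * (influence (pairs n) p (\<lambda>G. of_int (T v u G)) {u, u'})\<^sup>2)"

lemma expectation_edge:
  assumes "u \<in> V - {v}"
  shows "Mean M (\<lambda>G. of_bool (G {u, v})) = p"
  using expectation_bit[OF finite_pairs _ p, of "{u, v}" n of_bool] assms v by (simp add: pair_in_pairs)

lemma expectation_edge_T:
  assumes u: "u \<in> V - {v}"
  shows "Mean M (\<lambda>G. of_bool (G {u, v}) * of_int (T v u G)) = p * mean_T u"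
proof -
  have "{{u, v}} \<inter> star u (V - {u, v}) = {}"
    by (auto simp: star_def doubleton_eq_iff)
  from expectation_indep[OF finite_pairs depends_on_bit[of of_bool] depends_on_T[of of_int] this, of n p]
  show ?thesis using expectation_edge[OF u] by (simp add: mean_T_def)
qed

text \<open>With the edges at \<open>v\<close> removed, the stars of \<open>u\<close> and
  \<open>u'\<close> share only \<open>{u, u'}\<close>. The covariance is a product of two influences
  of this edge, and the inequality of the means separates it into one Bessel term for each
  vertex.\<close>

lemma expectation_T_T:
  assumes u: "u \<in> V - {v}" "u' \<in> V - {v}" "u \<noteq> u'"
  shows "Mean M (\<lambda>G. of_int (T v u G) * of_int (T v u' G)) \<le> mean_T u * mean_T u' + (edge_weight u u' + edge_weight u' u) / 2"
proof -
  let ?e = "{u, u'}" and ?q = "p * (1 - p)"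
  let ?i = "influence (pairs n) p (\<lambda>G. of_int (T v u G)) ?e"
    and ?j = "influence (pairs n) p (\<lambda>G. of_int (T v u' G)) ?e"
  have s: "star u (V - {u, v}) = insert ?e (star u (V - {u, v, u'}))"
    "star u' (V - {u', v}) = insert ?e (star u' (V - {u', v, u}))"
    using u by (auto simp: star_def insert_commute)
  have d: "depends_on (\<lambda>G. real_of_int (T v u G)) (insert ?e (star u (V - {u, v, u'})))"
    "depends_on (\<lambda>G. real_of_int (T v u' G)) (insert ?e (star u' (V - {u', v, u})))"
    unfolding s[symmetric] by (rule depends_on_T)+
  have "Mean M (\<lambda>G. of_int (T v u G) * of_int (T v u' G)) = mean_T u * mean_T u' + ?q * ?i * ?j"
    unfolding mean_T_def using u
    by (intro covariance_sharing_one_bit[OF finite_pairs _ p d] pair_in_pairs)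
      (auto simp: star_def doubleton_eq_iff)
  also have "?q * ?i * ?j = ?q * (?i * ?j)" by simp
  also have "\<dots> \<le> ?q * ((?i\<^sup>2 + ?j\<^sup>2) / 2)"
    using p sum_squares_bound[of ?i ?j] by (intro mult_left_mono) auto
  also have "\<dots> = (edge_weight u u' + edge_weight u' u) / 2"
  proof -
    have "edge_weight u u' = ?q * ?i\<^sup>2" "edge_weight u' u = ?q * ?j\<^sup>2" using u by (auto simp: edge_weight_def insert_commute)
    then show ?thesis by (simp only: distrib_left times_divide_eq_right)
  qed
  finally show ?thesis by simp
qed

text \<open>Bessel's inequality over the edges at \<open>u\<close>, for a function whose square is
  1.\<close>

lemma sum_edge_weight_le:
  assumes u: "u \<in> V - {v}"
  shows "(\<Sum>u'\<in>V - {v}. edge_weight u u') \<le> 1"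
proof -
  let ?f = "\<lambda>G. real_of_int (T v u G)"
  have "(\<Sum>u'\<in>V - {v}. edge_weight u u') = (\<Sum>u'\<in>V - {v} - {u}. p * (1 - p) * (influence (pairs n) p ?f {u, u'})\<^sup>2)"
    by (intro sum.mono_neutral_cong_right) (auto simp: edge_weight_def)
  also have "\<dots> = (\<Sum>e\<in>star u (V - {v} - {u}). p * (1 - p) * (influence (pairs n) p ?f e)\<^sup>2)"
    by (simp add: star_def sum.reindex[OF inj_on_star])
  also have "\<dots> \<le> Mean M (\<lambda>G. (?f G)\<^sup>2)"
    using u by (intro sum_influence_le[OF finite_pairs _ p] star_subset_pairs) auto
  also have "(\<lambda>G. (?f G)\<^sup>2) = (\<lambda>_. 1)"
    using T_sq[of u v] u by (metis DiffD1 of_int_1 of_int_power)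
  finally show ?thesis by simp
qed

text \<open>On the diagonal the product is just the edge indicator. Off it, the two edges at
  \<open>v\<close> are independent of both states, and the factor \<open>p\<^sup>2\<close> comes
  out.\<close>

lemma expectation_edge_T_edge_T:
  assumes u: "u \<in> V - {v}" "u' \<in> V - {v}"
  shows "Mean M (\<lambda>G. (of_bool (G {u, v}) * of_int (T v u G)) * (of_bool (G {u', v}) * of_int (T v u' G)))
    \<le> p\<^sup>2 * (mean_T u * mean_T u') + ((if u = u' then p else 0) + p\<^sup>2 * ((edge_weight u u' + edge_weight u' u) / 2))"
proof (cases "u = u'")
  case True
  have "(\<lambda>G. (of_bool (G {u, v}) * of_int (T v u G)) * (of_bool (G {u, v}) * of_int (T v u G)))
     = (\<lambda>G. of_bool (G {u, v}) :: real)"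
    using T_sq[of u v] u by (intro ext) (auto simp flip: of_int_mult simp: power2_eq_square)
  then have "Mean M (\<lambda>G. (of_bool (G {u, v}) * of_int (T v u G)) * (of_bool (G {u', v}) * of_int (T v u' G))) = p"
    using expectation_edge[OF u(1)] True by simp
  moreover have "0 \<le> p\<^sup>2 * (mean_T u * mean_T u')" "edge_weight u u' = 0" using True by (auto simp: edge_weight_def)
  ultimately show ?thesis using True by simp
next
  case False
  have d1: "depends_on (\<lambda>G. of_bool (G {u, v}) * of_bool (G {u', v}) :: real) {{u, v}, {u', v}}"
    by (auto simp: depends_on_def)
  have d2: "depends_on (\<lambda>G. real_of_int (T v u G) * of_int (T v u' G)) (star u (V - {u, v}) \<union> star u' (V - {u', v}))"
    by (rule depends_on_comp2[where h="(*)"]; rule depends_on_mono[OF depends_on_T[of of_int]]) auto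
  have disj: "{{u, v}, {u', v}} \<inter> (star u (V - {u, v}) \<union> star u' (V - {u', v})) = {}"
    using False u by (auto simp: star_def doubleton_eq_iff)
  have "Mean M (\<lambda>G. of_bool (G {u, v}) * of_bool (G {u', v})) = p * p"
    using expectation_two_bits[OF finite_pairs p, of "{u, v}" n "{u', v}" of_bool of_bool] u v False
    by (auto simp: pair_in_pairs doubleton_eq_iff)
  with expectation_indep[OF finite_pairs d1 d2 disj, of n p]
  have "Mean M (\<lambda>G. (of_bool (G {u, v}) * of_int (T v u G)) * (of_bool (G {u', v}) * of_int (T v u' G)))
     = p\<^sup>2 * Mean M (\<lambda>G. of_int (T v u G) * of_int (T v u' G))"
    by (simp add: power2_eq_square mult_ac)
  also have "\<dots> \<le> p\<^sup>2 * (mean_T u * mean_T u' + (edge_weight u u' + edge_weight u' u) / 2)"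
    by (intro mult_left_mono expectation_T_T[OF u False]) simp
  finally show ?thesis using False by (simp add: algebra_simps)
qed

text \<open>The diagonal contributes at most p n to the variance, and the covariances at most
  \<open>p\<^sup>2\<close> times the total edge weight, which is at most n.\<close>

lemma second_round_variance:
  defines "X \<equiv> \<lambda>G. real_of_int (\<Sum>u\<in>V - {v}. of_bool (G {u, v}) * T v u G)"
  shows "Mean M X = p * (\<Sum>u\<in>V - {v}. mean_T u)"
    and "Mean M (\<lambda>G. (X G - Mean M X)\<^sup>2) \<le> 2 * p * n"
proof -
  let ?U = "V - {v}"
  let ?Y = "\<lambda>u G. of_bool (G {u, v}) * real_of_int (T v u G)"
  have X: "X = (\<lambda>G. \<Sum>u\<in>?U. ?Y u G)"
    by (auto simp: X_def)
  show EX: "Mean M X = p * (\<Sum>u\<in>?U. mean_T u)"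
    unfolding X by (subst Bochner_Integration.integral_sum[OF integrable_M])
      (simp add: sum_distrib_left expectation_edge_T del: sum_of_bool_mult_eq)
  have KK: "(\<Sum>u\<in>?U. \<Sum>u'\<in>?U. edge_weight u u') \<le> n"
  proof -
    have "(\<Sum>u\<in>?U. \<Sum>u'\<in>?U. edge_weight u u') \<le> (\<Sum>u\<in>?U. 1)"
      by (intro sum_mono sum_edge_weight_le)
    then show ?thesis using v by simp
  qed
  have "Mean M (\<lambda>G. (X G)\<^sup>2) = (\<Sum>u\<in>?U. \<Sum>u'\<in>?U. Mean M (\<lambda>G. ?Y u G * ?Y u' G))"
    unfolding X power2_eq_square sum_product
    by (simp only: Bochner_Integration.integral_sum[OF integrable_M])
  also have "\<dots> \<le> (\<Sum>u\<in>?U. \<Sum>u'\<in>?U. p\<^sup>2 * (mean_T u * mean_T u') + ((if u = u' then p else 0) + p\<^sup>2 * ((edge_weight u u' + edge_weight u' u) / 2)))"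
    by (intro sum_mono expectation_edge_T_edge_T)
  also have "\<dots> = (Mean M X)\<^sup>2 + p * (n - 1) + p\<^sup>2 * (((\<Sum>u\<in>?U. \<Sum>u'\<in>?U. edge_weight u u') + (\<Sum>u\<in>?U. \<Sum>u'\<in>?U. edge_weight u' u)) / 2)"
  proof -
    have "(\<Sum>u\<in>?U. \<Sum>u'\<in>?U. p\<^sup>2 * (mean_T u * mean_T u')) = (Mean M X)\<^sup>2"
      by (simp add: EX power_mult_distrib power2_eq_square sum_product sum_distrib_left mult_ac)
    moreover have "(\<Sum>u\<in>?U. \<Sum>u'\<in>?U. if u = u' then p else 0) = p * (n - 1)"
      using v by simp
    ultimately show ?thesis
      by (simp only: sum.distrib sum_distrib_left[symmetric] sum_divide_distrib[symmetric] add.assoc)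
  qed
  also have "(\<Sum>u\<in>?U. \<Sum>u'\<in>?U. edge_weight u' u) = (\<Sum>u\<in>?U. \<Sum>u'\<in>?U. edge_weight u u')"
    by (rule sum.swap)
  finally have "Mean M (\<lambda>G. (X G)\<^sup>2) \<le> (Mean M X)\<^sup>2 + p * (n - 1) + p\<^sup>2 * (\<Sum>u\<in>?U. \<Sum>u'\<in>?U. edge_weight u u')"
    by simp
  also have "p\<^sup>2 * (\<Sum>u\<in>?U. \<Sum>u'\<in>?U. edge_weight u u') \<le> p * n"
    using p KK power_decreasing[of 1 2 p] by (intro mult_mono sum_nonneg) (auto simp: edge_weight_def)
  also have "p * real (n - 1) \<le> p * n" using p by (intro mult_left_mono) auto
  finally have "Mean M (\<lambda>G. (X G)\<^sup>2) \<le> (Mean M X)\<^sup>2 + 2 * p * n" by simp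
  moreover have "Mean M (\<lambda>G. (X G - Mean M X)\<^sup>2) = Mean M (\<lambda>G. (X G)\<^sup>2) - (Mean M X)\<^sup>2"
    by (rule measure_pmf.variance_eq) (rule integrable_M)+
  ultimately show "Mean M (\<lambda>G. (X G - Mean M X)\<^sup>2) \<le> 2 * p * n" by simp
qed

text \<open>A wrong vertex has a neighbourhood sum X \<le> 0, a deviation by at least the mean, so
  Chebyshev applies. With variance at most 2 p n and mean at least p n m / 2 the constant is 8 *
  320^2 = 819200.\<close>

lemma prob_second_round_wrong:
  assumes c: "0 < c" "c \<le> 1" "c * sqrt n \<le> of_int (\<Sum>w\<in>V. S w)" and x: "20 \<le> c * p * sqrt n"
  shows "Pr M {G. maj_state n G S 2 v \<noteq> 1} \<le> 819200 / (c\<^sup>2 * p\<^sup>2 * n)"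
proof -
  define X where "X = (\<lambda>G. real_of_int (\<Sum>u\<in>V - {v}. of_bool (G {u, v}) * T v u G))"
  define m where "m = c * sqrt p / 320"
  have p0: "0 < p" using x p by (cases "p = 0") auto
  have n0: "n \<noteq> 0" using x by (intro notI) auto
  \<comment> \<open>Needed to replace n - 1 by n / 2 in the bound on the mean.\<close>
  have n2: "2 \<le> n"
  proof (rule ccontr)
    assume "\<not> 2 \<le> n"
    then have "n = 1" using n0 by simp
    then have "20 \<le> c * p" using x by simp
    moreover have "c * p \<le> 1 * 1" using c p by (intro mult_mono) auto
    ultimately show False by simp
  qed
  have m: "0 < m" using c p0 by (simp add: m_def)
  have "real (n - 1) * m = (\<Sum>u\<in>V - {v}. m)" using v by simp
  also have "\<dots> \<le> (\<Sum>u\<in>V - {v}. mean_T u)"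
    unfolding m_def mean_T_def using c x v by (intro sum_mono expectation_T_ge) auto
  finally have "p * (real (n - 1) * m) \<le> Mean M X"
    unfolding X_def second_round_variance(1) using p by (intro mult_left_mono)
  moreover have "p * (real n / 2 * m) \<le> p * (real (n - 1) * m)"
    using m p n2 by (intro mult_left_mono mult_right_mono) (auto simp: of_nat_diff)
  ultimately have EX: "p * n * m / 2 \<le> Mean M X" by simp
  have EX0: "0 < p * n * m / 2" using p0 n0 m by simp
  have sub: "{G. maj_state n G S 2 v \<noteq> 1} \<subseteq> {G. Mean M X \<le> \<bar>X G - Mean M X\<bar>}"
  proof clarify
    fix G assume bad: "maj_state n G S 2 v \<noteq> 1"
    have "maj_state n G S 2 v = maj_step n G (maj_step n G S) v"
      by (simp add: maj_state_def numeral_2_eq_2)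
    then have "maj_state n G S 2 v = 1" if "0 < (\<Sum>u\<in>nbhd n G v. maj_step n G S u)"
      using that by (simp add: maj_step_def[of n G "maj_step n G S"] Let_def)
    with bad have "X G \<le> 0"
      unfolding second_round_sum[OF v] X_def by (metis not_le of_int_le_0_iff)
    then show "Mean M X \<le> \<bar>X G - Mean M X\<bar>" by simp
  qed
  have "Pr M {G. maj_state n G S 2 v \<noteq> 1} \<le> Pr M {G. Mean M X \<le> \<bar>X G - Mean M X\<bar>}"
    by (intro measure_pmf.finite_measure_mono sub) simp
  also have "\<dots> \<le> Mean M (\<lambda>G. (X G - Mean M X)\<^sup>2) / (Mean M X)\<^sup>2"
    using EX EX0 by (intro Chebyshev_prob finite_set_bits finite_pairs) linarith
  also have "\<dots> \<le> (2 * p * n) / (p * n * m / 2)\<^sup>2"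
    using second_round_variance(2) EX EX0 p
    by (intro frac_le power_mono) (use n0 in \<open>auto simp: X_def\<close>)
  also have "\<dots> = 819200 / (c\<^sup>2 * p\<^sup>2 * n)"
  proof -
    have sq: "(p * n * m / 2)\<^sup>2 = p\<^sup>2 * n\<^sup>2 * (c\<^sup>2 * p) / 409600"
      using p by (simp add: m_def power_mult_distrib power_divide)
    show ?thesis unfolding sq using p0 n0 c by (simp add: field_simps power2_eq_square)
  qed
  finally show ?thesis .
qed

end

end

section \<open>The last two rounds\<close>

lemma finite_nbhd [simp]: "finite (nbhd n G v)"
  by (simp add: nbhd_def)

lemma maj_step_eq_1:
  assumes R: "\<And>u. u \<in> vertices n \<Longrightarrow> R u = 1 \<or> R u = -1"
    and few: "2 * card (nbhd n G v \<inter> {u\<in>vertices n. R u \<noteq> 1}) < card (nbhd n G v)"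
  shows "maj_step n G R v = 1"
proof -
  let ?N = "nbhd n G v" and ?B = "{u\<in>vertices n. R u \<noteq> 1}"
  have "(\<Sum>u\<in>?N. R u) = (\<Sum>u\<in>?N. 1 - 2 * of_bool (u \<in> ?B))"
    using R by (intro sum.cong) (auto simp: nbhd_def)
  also have "\<dots> = int (card ?N) - 2 * int (card (?N \<inter> ?B))"
    by (simp add: sum_subtractf sum_distrib_left[symmetric] Int_def nbhd_def conj_ac)
  finally show ?thesis using few by (simp add: maj_step_def Let_def)
qed

lemma maj_step_pm1:
  assumes "R u = 1 \<or> R u = -1"
  shows "maj_step n G R u = 1 \<or> maj_step n G R u = -1"
  using assms by (auto simp: maj_step_def Let_def sgn_if)

text \<open>Double counting: each vertex wrong after the first of these rounds has at least half of
  its more than d / 4 neighbours in the initially wrong set, so the set of such vertices sends too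
  many edges there unless it has fewer than d / 10 elements. Then it is less than half of any
  neighbourhood.\<close>

lemma two_rounds_finish:
  fixes d \<beta> :: real
  assumes R: "\<And>u. u \<in> vertices n \<Longrightarrow> R u = 1 \<or> R u = -1"
    and deg: "\<And>v. v \<in> vertices n \<Longrightarrow> d / 4 < card (nbhd n G v)"
    and few: "card {u\<in>vertices n. R u \<noteq> 1} \<le> \<beta>"
    and expander: "\<And>B C. B \<subseteq> vertices n \<Longrightarrow> C \<subseteq> vertices n \<Longrightarrow> card B \<le> \<beta> \<Longrightarrow> d / 10 \<le> card C
      \<Longrightarrow> (\<Sum>v\<in>C. card (nbhd n G v \<inter> B)) < card C * d / 8"
    and v: "v \<in> vertices n"
  shows "maj_step n G (maj_step n G R) v = 1"
proof -
  let ?B = "{u\<in>vertices n. R u \<noteq> 1}" and ?C = "{u\<in>vertices n. maj_step n G R u \<noteq> 1}"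
  have "real (card ?C) * d / 8 \<le> (\<Sum>v\<in>?C. card (nbhd n G v \<inter> ?B))"
  proof -
    have "d / 8 \<le> card (nbhd n G v \<inter> ?B)" if v: "v \<in> ?C" for v
    proof -
      have "\<not> 2 * card (nbhd n G v \<inter> ?B) < card (nbhd n G v)"
        using maj_step_eq_1[of n R G v] R v by blast
      then show ?thesis using deg[of v] v by simp
    qed
    from sum_mono[OF this, of ?C "\<lambda>v. v"] show ?thesis by simp
  qed
  moreover have "?B \<subseteq> vertices n" "?C \<subseteq> vertices n" by auto
  note expander[OF this few]
  ultimately have C: "card ?C < d / 10" by linarith
  have "card (nbhd n G v \<inter> ?C) \<le> card ?C"
    by (intro card_mono) auto
  then have "real (2 * card (nbhd n G v \<inter> ?C)) < card (nbhd n G v)"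
    using C deg[OF v] by (simp add: field_simps)
  then show ?thesis
    using R maj_step_pm1 by (intro maj_step_eq_1) (blast, simp only: of_nat_less_iff)
qed

section \<open>Minimum degree and edge counts between vertex sets\<close>

context
  fixes n :: nat and p :: real
  assumes p: "0 \<le> p" "p \<le> 1"
begin

text \<open>Lower tail at every vertex and a union bound; the 1/2 in the exponent covers the n - 1
  in place of n potential neighbours.\<close>

lemma prob_min_degree:
  "Pr (bits (pairs n) p) {G. \<exists>v\<in>vertices n. card (nbhd n G v) \<le> p * n / 4} \<le> n * exp (1 / 2 - p * n / 4)"
proof -
  have one: "Pr (bits (pairs n) p) {G. card (nbhd n G v) \<le> p * n / 4} \<le> exp (1 / 2 - p * n / 4)" if v: "v \<in> vertices n" for v
  proof -
    have "card (nbhd n G v) = ones (star v (vertices n - {v})) G" for G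
      using nbhd_sum[of "\<lambda>_. 1 :: int" n G v] by (simp add: ones_star insert_commute)
    then have "Pr (bits (pairs n) p) {G. card (nbhd n G v) \<le> p * n / 4} = Pr (bits (pairs n) p) {G. of_int (ones (star v (vertices n - {v})) G) \<le> p * n / 4}"
      by (metis of_int_of_nat_eq)
    also have "\<dots> \<le> exp (p * n / 4 - p * card (star v (vertices n - {v})) / 2)"
      using v by (intro prob_ones_le[OF finite_pairs _ p] star_subset_pairs) auto
    also have "card (star v (vertices n - {v})) = n - 1"
      using v by (simp add: card_star)
    also have "p * n / 4 - p * real (n - 1) / 2 \<le> 1 / 2 - p * n / 4"
      using p v by (cases n) (auto simp: field_simps)
    finally show ?thesis by simp
  qed
  have "{G. \<exists>v\<in>vertices n. card (nbhd n G v) \<le> p * n / 4} = (\<Union>v\<in>vertices n. {G. card (nbhd n G v) \<le> p * n / 4})"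
    by auto
  then have "Pr (bits (pairs n) p) {G. \<exists>v\<in>vertices n. card (nbhd n G v) \<le> p * n / 4} \<le> (\<Sum>v\<in>vertices n. Pr (bits (pairs n) p) {G. card (nbhd n G v) \<le> p * n / 4})"
    by (simp only:) (rule measure_pmf.finite_measure_subadditive_finite; simp)
  also have "\<dots> \<le> (\<Sum>v\<in>vertices n. exp (1 / 2 - p * n / 4))"
    by (intro sum_mono one)
  finally show ?thesis by simp
qed

text \<open>The expected count is at most p |B| |C| \<le> |C| p n / 32, a quarter of the threshold.
  The Chernoff bound with tilt 1/2 turns this gap into the exponent |C| p n / 32 - |C| p n /
  16.\<close>

lemma prob_many_edges_between:
  assumes B: "B \<subseteq> vertices n" and C: "C \<subseteq> vertices n" and small: "card B \<le> n / 32"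
  shows "Pr (bits (pairs n) p) {G. card C * (p * n) / 8 \<le> (\<Sum>v\<in>C. card (nbhd n G v \<inter> B))} \<le> exp (- (card C * (p * n) / 32))"
proof -
  \<comment> \<open>Ordered pairs, since an edge inside \<open>B \<inter> C\<close> is counted from
    both ends; \<open>w e\<close> in {0, 1, 2} is the resulting multiplicity of the bit
    \<open>e\<close>.\<close>
  define Q where "Q = {(u, v) \<in> B \<times> C. u \<noteq> v}"
  define \<phi> where "\<phi> = (\<lambda>(u, v). {u, v} :: nat set)"
  define w where "w = (\<lambda>e. card {q\<in>Q. \<phi> q = e})"
  have fin: "finite B" "finite C" using finite_subset[OF B] finite_subset[OF C] by auto
  have finQ: "finite Q" by (rule finite_subset[of _ "B \<times> C"]) (use fin in \<open>auto simp: Q_def\<close>)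
  have \<phi>: "\<phi> ` Q \<subseteq> pairs n" using B C by (auto simp: Q_def \<phi>_def intro!: pair_in_pairs)
  have grp: "(\<Sum>q\<in>Q. h (\<phi> q)) = (\<Sum>e\<in>pairs n. w e * h e)" for h :: "_ \<Rightarrow> real"
  proof -
    have "(\<Sum>q\<in>Q. h (\<phi> q)) = (\<Sum>e\<in>pairs n. \<Sum>q\<in>{q\<in>Q. \<phi> q = e}. h (\<phi> q))"
      by (rule sum.group[OF finQ finite_pairs \<phi>, symmetric])
    also have "\<dots> = (\<Sum>e\<in>pairs n. w e * h e)"
      by (intro sum.cong) (auto simp: w_def)
    finally show ?thesis .
  qed
  have cnt: "real (\<Sum>v\<in>C. card (nbhd n G v \<inter> B)) = (\<Sum>e\<in>pairs n. w e * of_bool (G e))" for G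
  proof -
    have "(\<Sum>v\<in>C. card (nbhd n G v \<inter> B)) = card (SIGMA v:C. nbhd n G v \<inter> B)"
      using fin by (simp add: card_SigmaI)
    also have "\<dots> = card {q\<in>Q. G (\<phi> q)}"
    proof -
      have "{q\<in>Q. G (\<phi> q)} = prod.swap ` (SIGMA v:C. nbhd n G v \<inter> B)"
        using B by (auto simp: Q_def \<phi>_def nbhd_def)
      then show ?thesis by (simp only: card_image[OF inj_swap])
    qed
    also have "real \<dots> = (\<Sum>q\<in>Q. of_bool (G (\<phi> q)))"
      using finQ by (simp add: Int_def)
    finally show ?thesis using grp[of "\<lambda>e. of_bool (G e)"] by simp
  qed
  have w2: "w e \<le> 2" for e
  proof (cases "{q\<in>Q. \<phi> q = e} = {}")
    case False
    then obtain q where q: "\<phi> q = e" by blast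
    have "{r\<in>Q. \<phi> r = e} \<subseteq> {q, prod.swap q}"
    proof
      fix r assume "r \<in> {r\<in>Q. \<phi> r = e}"
      then have "{fst r, snd r} = {fst q, snd q}" using q by (simp add: \<phi>_def case_prod_beta)
      then show "r \<in> {q, prod.swap q}" by (simp add: doubleton_eq_iff prod_eq_iff)
    qed
    then have "w e \<le> card {q, prod.swap q}" unfolding w_def by (rule card_mono[rotated]) simp
    also have "\<dots> \<le> 2" using card_insert_le_m1[of 2 "{prod.swap q}" q] by simp
    finally show ?thesis .
  next
    case True
    then show ?thesis unfolding w_def by (simp only: card.empty)
  qed
  \<comment> \<open>For multiplicity 1 and 2 this is exp (1/2) \<le> 2 and exp 1 \<le> 3, so after
    tilting the mean is bounded by the plain count of pairs.\<close>
  have ew: "exp (w e / 2) - 1 \<le> w e" for e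
  proof -
    have e2: "exp (1 / 2 :: real) \<le> 2" using exp_bound[of "1 / 2 :: real"] by (simp add: power2_eq_square)
    have e3: "exp (1 :: real) \<le> 3" by (rule exp_le)
    have "w e = 0 \<or> w e = 1 \<or> w e = 2" using w2[of e] by linarith
    then show ?thesis using e2 e3 by (elim disjE) simp_all
  qed
  have "card Q \<le> card (B \<times> C)"
    using fin by (intro card_mono) (auto simp: Q_def)
  then have "real (card Q) \<le> real (card B) * card C"
    by (simp only: card_cartesian_product of_nat_le_iff flip: of_nat_mult)
  then have sw: "(\<Sum>e\<in>pairs n. real (w e)) \<le> real (card B) * card C"
    using grp[of "\<lambda>_. 1"] by simp
  have "{G. card C * (p * n) / 8 \<le> real (\<Sum>v\<in>C. card (nbhd n G v \<inter> B))}
      = {G. card C * (p * n) / 16 \<le> (\<Sum>e\<in>pairs n. real (w e) / 2 * of_bool (G e))}"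
  proof -
    have half: "(\<Sum>e\<in>pairs n. real (w e) / 2 * of_bool (G e)) = (\<Sum>e\<in>pairs n. w e * of_bool (G e)) / 2" for G
      by (simp add: sum_divide_distrib del: sum_mult_of_bool_eq)
    show ?thesis unfolding cnt half by (intro Collect_cong iffI; linarith)
  qed
  then have "Pr (bits (pairs n) p) {G. card C * (p * n) / 8 \<le> (\<Sum>v\<in>C. card (nbhd n G v \<inter> B))}
     \<le> exp (p * (\<Sum>e\<in>pairs n. exp (real (w e) / 2) - 1) - card C * (p * n) / 16)"
    using Chernoff_bits[OF finite_pairs p, where a="card C * (p * n) / 16" and c="\<lambda>e. real (w e) / 2"]
    by (simp only:)
  also have "\<dots> \<le> exp (- (card C * (p * n) / 32))"
  proof -
    have "(\<Sum>e\<in>pairs n. exp (real (w e) / 2) - 1) \<le> (\<Sum>e\<in>pairs n. real (w e))"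
      by (intro sum_mono ew)
    also have "\<dots> \<le> n / 32 * card C"
      using sw mult_right_mono[OF small, of "card C"] by simp
    finally have "p * (\<Sum>e\<in>pairs n. exp (real (w e) / 2) - 1) \<le> p * (n / 32 * card C)"
      using p(1) by (rule mult_left_mono)
    moreover have "p * (n / 32 * card C) = card C * (p * n) / 32" by simp
    ultimately have "p * (\<Sum>e\<in>pairs n. exp (real (w e) / 2) - 1) - card C * (p * n) / 16 \<le> - (card C * (p * n) / 32)"
      by linarith
    then show ?thesis by (simp only: exp_le_cancel_iff)
  qed
  finally show ?thesis .
qed

text \<open>Union bound over at most \<open>4 ^ n\<close> pairs; p n / 10 \<le> |C| makes each
  exponent quadratic in p n, which beats \<open>4 ^ n\<close> once p sqrt n is a large
  constant.\<close>

lemma prob_not_expander: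
  "Pr (bits (pairs n) p) {G. \<exists>B C. B \<subseteq> vertices n \<and> C \<subseteq> vertices n \<and> card B \<le> n / 32 \<and> p * n / 10 \<le> card C
      \<and> card C * (p * n) / 8 \<le> (\<Sum>v\<in>C. card (nbhd n G v \<inter> B))} \<le> 4 ^ n * exp (- ((p * n)\<^sup>2 / 320))"
proof -
  define J where "J = {(B, C). B \<subseteq> vertices n \<and> C \<subseteq> vertices n \<and> card B \<le> n / 32 \<and> p * n / 10 \<le> card C}"
  define A where "A = (\<lambda>(B, C). {G. card C * (p * n) / 8 \<le> (\<Sum>v\<in>C. card (nbhd n G v \<inter> B))})"
  have sub: "J \<subseteq> Pow (vertices n) \<times> Pow (vertices n)" by (auto simp: J_def)
  then have finJ: "finite J" by (rule finite_subset) simp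
  have cJ: "card J \<le> 4 ^ n"
  proof -
    have "card J \<le> card (Pow (vertices n) \<times> Pow (vertices n))"
      by (rule card_mono[OF _ sub]) simp
    also have "\<dots> = 2 ^ n * 2 ^ n" by (simp only: card_cartesian_product card_Pow finite_vertices card_vertices)
    also have "\<dots> = (2 * 2) ^ n" by (rule power_mult_distrib[symmetric])
    finally show ?thesis by simp
  qed
  have "Pr (bits (pairs n) p) {G. \<exists>B C. B \<subseteq> vertices n \<and> C \<subseteq> vertices n \<and> card B \<le> n / 32 \<and> p * n / 10 \<le> card C
      \<and> card C * (p * n) / 8 \<le> (\<Sum>v\<in>C. card (nbhd n G v \<inter> B))} = Pr (bits (pairs n) p) (\<Union>j\<in>J. A j)"
    by (rule arg_cong[where f="Pr (bits (pairs n) p)"], unfold J_def A_def) blast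
  also have "\<dots> \<le> (\<Sum>j\<in>J. Pr (bits (pairs n) p) (A j))"
    by (rule measure_pmf.finite_measure_subadditive_finite[OF finJ]) auto
  also have "\<dots> \<le> (\<Sum>j\<in>J. exp (- ((p * n)\<^sup>2 / 320)))"
  proof (rule sum_mono)
    fix j assume "j \<in> J"
    then obtain B C where j: "j = (B, C)" "B \<subseteq> vertices n" "C \<subseteq> vertices n" "card B \<le> n / 32" "p * n / 10 \<le> card C"
      by (auto simp: J_def)
    have "Pr (bits (pairs n) p) (A j) \<le> exp (- (card C * (p * n) / 32))"
      using prob_many_edges_between[OF j(2,3,4)] by (simp add: A_def j)
    also have "\<dots> \<le> exp (- ((p * n)\<^sup>2 / 320))"
      using mult_right_mono[OF j(5), of "p * n"] p by (simp add: power2_eq_square mult_ac)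
    finally show "Pr (bits (pairs n) p) (A j) \<le> exp (- ((p * n)\<^sup>2 / 320))" .
  qed
  also have "\<dots> = real (card J) * exp (- ((p * n)\<^sup>2 / 320))" by simp
  also have "\<dots> \<le> 4 ^ n * exp (- ((p * n)\<^sup>2 / 320))"
  proof (rule mult_right_mono)
    have "real (card J) \<le> real (4 ^ n)" using cJ by (simp only: of_nat_le_iff)
    then show "real (card J) \<le> 4 ^ n" by simp
  qed simp
  finally show ?thesis .
qed

end

context dynamics
begin

text \<open>Markov's inequality turns the bound for one vertex into one for more than n / 32 wrong
  vertices (32 * 819200 = 26214400). The other two bad events concern only the graph and quantify
  over all sets \<open>B\<close> and \<open>C\<close>, so they apply to wrong sets that themselves
  depend on the graph.\<close>

lemma prob_not_unanimous:
  assumes c: "0 < c" "c \<le> 1" "c * sqrt n \<le> of_int (\<Sum>w\<in>V. S w)" and x: "20 \<le> c * p * sqrt n"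
  shows "Pr M {G. \<exists>v\<in>V. maj_state n G S 4 v \<noteq> 1}
    \<le> 26214400 / (c\<^sup>2 * p\<^sup>2 * n) + n * exp (1 / 2 - p * n / 4) + 4 ^ n * exp (- ((p * n)\<^sup>2 / 320))"
proof -
  define W where "W = (\<lambda>G. card {v\<in>V. maj_state n G S 2 v \<noteq> 1})"
  let ?A1 = "{G. n / 32 < W G}"
    and ?A2 = "{G. \<exists>v\<in>V. card (nbhd n G v) \<le> p * n / 4}"
    and ?A3 = "{G. \<exists>B C. B \<subseteq> V \<and> C \<subseteq> V \<and> card B \<le> n / 32 \<and> p * n / 10 \<le> card C
      \<and> card C * (p * n) / 8 \<le> (\<Sum>v\<in>C. card (nbhd n G v \<inter> B))}"
  have n0: "0 < n" using x by (intro Nat.gr0I) auto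
  have "Pr M ?A1 \<le> Mean M (\<lambda>G. W G / (n / 32))"
    using n0 by (intro prob_le_expectation finite_set_bits finite_pairs) (auto simp: field_simps)
  also have "(\<lambda>G. W G / (n / 32)) = (\<lambda>G. 32 / n * (\<Sum>v\<in>V. of_bool (maj_state n G S 2 v \<noteq> 1)))"
  proof
    fix G
    have "(\<Sum>v\<in>V. of_bool (maj_state n G S 2 v \<noteq> 1)) = real (W G)"
      by (simp add: W_def Int_def)
    then show "W G / (n / 32) = 32 / n * (\<Sum>v\<in>V. of_bool (maj_state n G S 2 v \<noteq> 1))"
      by (simp only:) simp
  qed
  also have "Mean M \<dots> = 32 / n * (\<Sum>v\<in>V. Pr M {G. maj_state n G S 2 v \<noteq> 1})"
    unfolding prob_eq_expectation
    by (simp only: integral_mult_right_zero Bochner_Integration.integral_sum[OF integrable_M])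
  also have "\<dots> \<le> 32 / n * (\<Sum>v\<in>V. 819200 / (c\<^sup>2 * p\<^sup>2 * n))"
    using prob_second_round_wrong[OF _ c x] by (intro mult_left_mono sum_mono) auto
  also have "\<dots> = 26214400 / (c\<^sup>2 * p\<^sup>2 * n)" using n0 by simp
  finally have A1: "Pr M ?A1 \<le> 26214400 / (c\<^sup>2 * p\<^sup>2 * n)" .
  have "{G. \<exists>v\<in>V. maj_state n G S 4 v \<noteq> 1} \<subseteq> ?A1 \<union> ?A2 \<union> ?A3"
  proof (rule subsetI, rule ccontr)
    fix G assume bad: "G \<in> {G. \<exists>v\<in>V. maj_state n G S 4 v \<noteq> 1}" and nA: "G \<notin> ?A1 \<union> ?A2 \<union> ?A3"
    have n1: "\<not> n / 32 < W G" and n2: "\<And>v. v \<in> V \<Longrightarrow> \<not> card (nbhd n G v) \<le> p * n / 4"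
      and n3: "\<And>B C. \<lbrakk>B \<subseteq> V; C \<subseteq> V; card B \<le> n / 32; p * n / 10 \<le> card C\<rbrakk>
        \<Longrightarrow> \<not> card C * (p * n) / 8 \<le> (\<Sum>v\<in>C. card (nbhd n G v \<inter> B))"
      using nA by blast+
    have 4: "maj_state n G S 4 = maj_step n G (maj_step n G (maj_state n G S 2))"
      by (simp add: maj_state_def numeral_eq_Suc)
    have "maj_step n G (maj_step n G (maj_state n G S 2)) v = 1" if "v \<in> V" for v
    proof (rule two_rounds_finish[where d="p * n" and \<beta>="n / 32"])
      show "maj_state n G S 2 u = 1 \<or> maj_state n G S 2 u = -1" if "u \<in> V" for u
        using S[OF that] by (simp add: maj_state_def numeral_2_eq_2 maj_step_pm1)
      show "p * n / 4 < card (nbhd n G v)" if "v \<in> V" for v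
        using n2[OF that] by (simp only: not_le)
      show "card {u\<in>V. maj_state n G S 2 u \<noteq> 1} \<le> n / 32" using n1 by (simp only: W_def not_less)
      show "(\<Sum>v\<in>C. card (nbhd n G v \<inter> B)) < card C * (p * n) / 8"
        if "B \<subseteq> V" "C \<subseteq> V" "card B \<le> n / 32" "p * n / 10 \<le> card C" for B C
        using n3[OF that] by (simp only: not_le)
    qed (fact that)
    with bad 4 show False by auto
  qed
  then have "Pr M {G. \<exists>v\<in>V. maj_state n G S 4 v \<noteq> 1} \<le> Pr M (?A1 \<union> ?A2 \<union> ?A3)"
    by (intro measure_pmf.finite_measure_mono) auto
  also have "\<dots> \<le> Pr M (?A1 \<union> ?A2) + Pr M ?A3"
    by (rule measure_Un_le) auto
  also have "Pr M (?A1 \<union> ?A2) \<le> Pr M ?A1 + Pr M ?A2"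
    by (rule measure_Un_le) auto
  also note A1
  also note prob_min_degree[OF p]
  also note prob_not_expander[OF p]
  finally show ?thesis by simp
qed

end

section \<open>The initial states\<close>

text \<open>Squaring avoids roots in the induction: the ratio of consecutive central coefficients is
  2 (2 m + 1) / (m + 1), and (2 m + 1) (2 m + 3) \<le> 4 (m + 1)^2.\<close>

lemma central_binomial_sq_le: "real ((2 * m) choose m) ^ 2 * (2 * m + 1) \<le> 16 ^ m"
proof (induction m)
  case (Suc m)
  define a where "a = real ((2 * m) choose m)"
  define b where "b = real ((2 * Suc m) choose Suc m)"
  have e1: "Suc (Suc (2 * m)) * (Suc (2 * m) choose m) = (Suc (Suc (2 * m)) choose Suc m) * Suc m"
    and e2: "Suc (2 * m) * ((2 * m) choose m) = (Suc (2 * m) choose Suc m) * Suc m"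
    by (rule Suc_times_binomial_eq)+
  have e3: "(Suc (2 * m) choose m) = (Suc (2 * m) choose Suc m)"
    using binomial_symmetric[of m "Suc (2 * m)"] by simp
  have "((2 * Suc m) choose Suc m) * Suc m = 2 * (Suc m * (Suc (2 * m) choose Suc m))"
    using e1 e3 by simp
  also have "\<dots> = 2 * (Suc (2 * m) * ((2 * m) choose m))"
    using e2 by (simp only: mult.commute)
  finally have "b * (real m + 1) = 2 * (2 * real m + 1) * a"
    unfolding a_def b_def by (metis (no_types, opaque_lifting) mult.assoc of_nat_Suc of_nat_mult of_nat_numeral add.commute)
  then have "(b * (real m + 1))\<^sup>2 * (2 * m + 3) = 4 * (2 * real m + 1) * (2 * real m + 3) * (a\<^sup>2 * (2 * m + 1))"
    by (simp add: power2_eq_square algebra_simps)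
  also have "\<dots> \<le> 4 * (2 * real m + 1) * (2 * real m + 3) * 16 ^ m"
    using Suc.IH by (intro mult_left_mono) (auto simp: a_def)
  also have "\<dots> \<le> 16 * (real m + 1)\<^sup>2 * 16 ^ m"
    by (intro mult_right_mono) (auto simp: power2_eq_square algebra_simps)
  finally have "(real m + 1)\<^sup>2 * (b\<^sup>2 * (2 * m + 3)) \<le> (real m + 1)\<^sup>2 * 16 ^ Suc m"
    by (simp add: power_mult_distrib mult_ac)
  then have "b\<^sup>2 * (2 * m + 3) \<le> 16 ^ Suc m"
    by (rule mult_left_le_imp_le) simp
  then show ?case by (simp add: b_def add.commute)
qed simp

lemma central_binomial_le: "real ((2 * m) choose m) * sqrt (2 * m + 1) \<le> 4 ^ m"
proof -
  have "(real ((2 * m) choose m) * sqrt (2 * m + 1))\<^sup>2 \<le> (4 ^ m)\<^sup>2"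
    using central_binomial_sq_le[of m] by (simp add: power_mult_distrib flip: power_mult)
      (simp add: power_mult mult.commute[of m 2])
  then show ?thesis by (rule power2_le_imp_le) simp
qed

text \<open>For odd n = 2 m + 1 the two equal middle coefficients add up to the central one of 2 m +
  2, so each is half of it.\<close>

lemma binomial_le: "real (n choose k) * sqrt n \<le> 2 ^ n"
proof (cases "even n")
  case True
  then obtain m where n: "n = 2 * m" by blast
  have "real (n choose k) * sqrt n \<le> real ((2 * m) choose m) * sqrt (2 * m + 1)"
    using binomial_maximum'[of m k] n by (intro mult_mono) auto
  also have "\<dots> \<le> 4 ^ m" by (rule central_binomial_le)
  finally show ?thesis by (simp add: n power_mult)
next
  case False
  then obtain m where n: "n = Suc (2 * m)" using oddE by fastforce
  have "n choose k \<le> n choose (n div 2)" by (rule binomial_maximum)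
  also have "n div 2 = m" by (simp add: n)
  finally have "n choose k \<le> n choose m" .
  moreover have "n choose m = n choose Suc m"
    using binomial_symmetric[of m n] by (simp add: n)
  moreover have "(2 * Suc m) choose Suc m = (n choose m) + (n choose Suc m)" by (simp add: n)
  ultimately have "2 * (n choose k) \<le> (2 * Suc m) choose Suc m" by linarith
  then have "2 * real (n choose k) \<le> real ((2 * Suc m) choose Suc m)" by linarith
  then have "2 * real (n choose k) * sqrt n \<le> real ((2 * Suc m) choose Suc m) * sqrt (2 * Suc m + 1)"
    by (intro mult_mono) (auto simp: n)
  also have "\<dots> \<le> 4 ^ Suc m" by (rule central_binomial_le)
  also have "(4::real) ^ Suc m = 2 * 2 ^ n" by (simp add: n power_mult)
  finally show ?thesis by simp
qed

section \<open>Anti-concentration of the initial sum\<close>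

lemma init_states_eq: "init_states n = pmf_of_set (PiE_dflt (vertices n) 0 (\<lambda>_. {-1, 1}))"
  unfolding init_states_def by (rule Pi_pmf_of_set) auto

lemma finite_init_support: "finite (PiE_dflt (vertices n) 0 (\<lambda>_. {-1, 1 :: int}))"
  by (rule finite_PiE_dflt) auto

lemma set_init_states: "set_pmf (init_states n) = PiE_dflt (vertices n) 0 (\<lambda>_. {-1, 1})"
  unfolding init_states_eq by (rule set_pmf_of_set[OF _ finite_init_support]) (simp add: PiE_dflt_empty_iff)

text \<open>A state is determined by its set of positive vertices, and the value of the sum fixes
  the size of that set, so at most one binomial coefficient out of \<open>2 ^ n\<close> states
  qualifies.\<close>

lemma prob_init_sum_eq:
  assumes n: "0 < n"
  shows "Pr (init_states n) {S. (\<Sum>u\<in>vertices n. S u) = j} \<le> 1 / sqrt n"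
proof -
  define \<Omega> where "\<Omega> = PiE_dflt (vertices n) 0 (\<lambda>_. {-1, 1 :: int})"
  let ?A = "\<Omega> \<inter> {S. (\<Sum>u\<in>vertices n. S u) = j}"
  define pos where "pos = (\<lambda>S :: nat \<Rightarrow> int. {u\<in>vertices n. S u = 1})"
  define k where "k = nat ((j + n) div 2)"
  have inj: "inj_on pos \<Omega>"
  proof (rule inj_onI, rule ext)
    fix S R u assume S: "S \<in> \<Omega>" and R: "R \<in> \<Omega>" and eq: "pos S = pos R"
    show "S u = R u"
    proof (cases "u \<in> vertices n")
      case True
      then have "S u = -1 \<or> S u = 1" "R u = -1 \<or> R u = 1" "S u = 1 \<longleftrightarrow> R u = 1"
        using S R eq by (auto simp: \<Omega>_def PiE_dflt_def pos_def)
      then show ?thesis by auto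
    next
      case False
      then show ?thesis using S R by (simp add: \<Omega>_def PiE_dflt_def)
    qed
  qed
  have "pos S \<in> {X. X \<subseteq> vertices n \<and> card X = k}" if "S \<in> ?A" for S
  proof -
    have "(\<Sum>u\<in>vertices n. S u) = (\<Sum>u\<in>vertices n. 2 * of_bool (u \<in> pos S) - 1)"
      using that by (intro sum.cong) (auto simp: \<Omega>_def PiE_dflt_def pos_def)
    also have "\<dots> = 2 * int (card (pos S)) - int n"
      by (simp add: sum_subtractf sum_distrib_left[symmetric] pos_def Int_def conj_ac)
    finally have "j = 2 * int (card (pos S)) - int n" using that by simp
    then have "card (pos S) = k" by (simp add: k_def)
    then show ?thesis by (auto simp: pos_def)
  qed
  then have "card ?A \<le> card {X. X \<subseteq> vertices n \<and> card X = k}"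
    using inj by (intro card_inj_on_le[of pos]) (auto intro: inj_on_subset)
  then have "card ?A \<le> n choose k" by (simp add: n_subsets)
  then have "real (card ?A) * sqrt n \<le> real (n choose k) * sqrt n"
    by (intro mult_right_mono) auto
  also have "\<dots> \<le> 2 ^ n" by (rule binomial_le)
  finally have cA: "real (card ?A) * sqrt n \<le> 2 ^ n" .
  have c\<Omega>: "card \<Omega> = 2 ^ n" unfolding \<Omega>_def by (subst card_PiE_dflt) (auto simp: numeral_2_eq_2)
  have "Pr (init_states n) {S. (\<Sum>u\<in>vertices n. S u) = j} = real (card ?A) / real (card \<Omega>)"
    unfolding init_states_eq \<Omega>_def by (rule measure_pmf_of_set[OF _ finite_init_support]) (simp add: PiE_dflt_empty_iff)
  also have "\<dots> \<le> 1 / sqrt n"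
    unfolding c\<Omega> using cA n by (simp add: field_simps)
  finally show ?thesis .
qed

text \<open>At most 2 c sqrt n + 1 integers are that small, each attained with probability at most 1
  / sqrt n.\<close>

lemma prob_init_sum_small:
  assumes n: "0 < n" and c: "0 \<le> c"
  shows "Pr (init_states n) {S. \<bar>of_int (\<Sum>u\<in>vertices n. S u)\<bar> < c * sqrt n} \<le> 2 * c + 1 / sqrt n"
proof -
  let ?f = "\<lfloor>c * sqrt n\<rfloor>"
  have f: "0 \<le> ?f" using c by simp
  have "{S. \<bar>of_int (\<Sum>u\<in>vertices n. S u)\<bar> < c * sqrt n} \<subseteq> (\<Union>j\<in>{- ?f..?f}. {S. (\<Sum>u\<in>vertices n. S u) = j})"
  proof
    fix S :: "nat \<Rightarrow> int" assume "S \<in> {S. \<bar>of_int (\<Sum>u\<in>vertices n. S u)\<bar> < c * sqrt n}"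
    then have "\<bar>real_of_int (\<Sum>u\<in>vertices n. S u)\<bar> < c * sqrt n" by simp
    then have "(\<Sum>u\<in>vertices n. S u) \<in> {- ?f..?f}" unfolding atLeastAtMost_iff by linarith
    then show "S \<in> (\<Union>j\<in>{- ?f..?f}. {S. (\<Sum>u\<in>vertices n. S u) = j})" by blast
  qed
  then have "Pr (init_states n) {S. \<bar>of_int (\<Sum>u\<in>vertices n. S u)\<bar> < c * sqrt n}
      \<le> Pr (init_states n) (\<Union>j\<in>{- ?f..?f}. {S. (\<Sum>u\<in>vertices n. S u) = j})"
    by (rule measure_pmf.finite_measure_mono) simp
  also have "\<dots> \<le> (\<Sum>j\<in>{- ?f..?f}. Pr (init_states n) {S. (\<Sum>u\<in>vertices n. S u) = j})"
    by (rule measure_pmf.finite_measure_subadditive_finite) auto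
  also have "\<dots> \<le> (\<Sum>j\<in>{- ?f..?f}. 1 / sqrt n)"
    by (intro sum_mono prob_init_sum_eq n)
  also have "\<dots> = (2 * of_int ?f + 1) / sqrt n"
    using f by simp
  also have "\<dots> \<le> (2 * (c * sqrt n) + 1) / sqrt n"
    using of_int_floor_le[of "c * sqrt n"] by (intro divide_right_mono) (linarith, simp)
  also have "\<dots> = 2 * c + 1 / sqrt n"
    using n by (simp add: field_simps)
  finally show ?thesis .
qed

section \<open>Sign symmetry and averaging over the initial state\<close>

lemma maj_state_uminus: "maj_state n G (\<lambda>u. - S u) t = (\<lambda>u. - maj_state n G S t u)"
proof (induction t)
  case (Suc t)
  \<comment> \<open>A tie keeps the old state, so the step commutes with negation in that case
    too.\<close>
  then show ?case
    by (auto simp: maj_state_def maj_step_def Let_def sum_negf sgn_minus)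
qed (simp add: maj_state_def)

text \<open>Integrate over the second component first chosen: where \<open>B\<close> holds the inner
  probability is at most 1, elsewhere at most \<delta>.\<close>

lemma prob_pair_le:
  assumes fin: "finite (set_pmf P)" "finite (set_pmf Q)"
    and bound: "\<And>y. y \<in> set_pmf Q \<Longrightarrow> \<not> B y \<Longrightarrow> Pr P {x. R x y} \<le> \<delta>" and \<delta>: "0 \<le> \<delta>"
  shows "Pr (pair_pmf P Q) {(x, y). R x y} \<le> Pr Q {y. B y} + \<delta>"
proof -
  have "Pr (pair_pmf P Q) {(x, y). R x y} = Mean (pair_pmf P Q) (\<lambda>z. of_bool (R (fst z) (snd z)))"
    using prob_eq_expectation[of "pair_pmf P Q" "\<lambda>z. R (fst z) (snd z)"] by (simp add: case_prod_beta')
  also have "\<dots> = Mean (pair_pmf Q P) (\<lambda>z. of_bool (R (snd z) (fst z)))"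
    by (subst pair_commute_pmf) (simp add: case_prod_beta)
  also have "\<dots> = Mean Q (\<lambda>y. Pr P {x. R x y})"
    by (subst expectation_pair_pmf_finite[OF fin(2,1)]) (simp add: prob_eq_expectation)
  also have "\<dots> \<le> Mean Q (\<lambda>y. of_bool (B y) + \<delta>)"
  proof (rule integral_mono_AE)
    show "AE y in Q. Pr P {x. R x y} \<le> of_bool (B y) + \<delta>"
      unfolding AE_measure_pmf_iff
    proof
      fix y assume "y \<in> set_pmf Q"
      then show "Pr P {x. R x y} \<le> of_bool (B y) + \<delta>"
        using bound[of y] \<delta> measure_pmf.prob_le_1[of P "{x. R x y}"] by (cases "B y") (auto simp: add_increasing2)
    qed
  qed (intro integrable_finite_set_pmf fin)+
  also have "\<dots> = Pr Q {y. B y} + \<delta>"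
    using fin by (simp add: prob_eq_expectation integrable_finite_set_pmf)
  finally show ?thesis .
qed

text \<open>A negative sum is reduced to a positive one by negating the initial state.\<close>

lemma prob_wrong_given_init:
  assumes p: "0 \<le> p" "p \<le> 1" and S: "S \<in> set_pmf (init_states n)"
    and c: "0 < c" "c \<le> 1" "c * sqrt n \<le> \<bar>of_int (\<Sum>u\<in>vertices n. S u)\<bar>" and x: "20 \<le> c * p * sqrt n"
  shows "Pr (gnp n p) {G. \<not> (\<forall>v\<in>vertices n. maj_state n G S 4 v = sgn (\<Sum>u\<in>vertices n. S u))}
    \<le> 26214400 / (c\<^sup>2 * p\<^sup>2 * n) + n * exp (1 / 2 - p * n / 4) + 4 ^ n * exp (- ((p * n)\<^sup>2 / 320))"
proof -
  have S1: "S u = 1 \<or> S u = -1" if "u \<in> vertices n" for u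
    using S that by (auto simp: set_init_states PiE_dflt_def)
  have "0 < c * sqrt n" using x p c by (cases n) auto
  then have "(\<Sum>u\<in>vertices n. S u) \<noteq> 0" using c(3) by (metis abs_zero not_less of_int_0)
  then consider "0 < (\<Sum>u\<in>vertices n. S u)" | "(\<Sum>u\<in>vertices n. S u) < 0" by linarith
  then show ?thesis
  proof cases
    case 1
    interpret dynamics n p S by unfold_locales (use p S1 in auto)
    have "c * sqrt n \<le> of_int (\<Sum>u\<in>vertices n. S u)" using c(3) 1 by (simp only: abs_of_pos of_int_0_less_iff)
    from prob_not_unanimous[OF c(1,2) this x] show ?thesis
      using 1 by (simp add: gnp_def)
  next
    case 2
    interpret dynamics n p "\<lambda>u. - S u" by unfold_locales (use p S1 in auto)
    have "c * sqrt n \<le> of_int (\<Sum>u\<in>vertices n. - S u)" using c(3) 2 by (simp only: abs_of_neg of_int_less_0_iff sum_negf of_int_minus)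
    from prob_not_unanimous[OF c(1,2) this x] show ?thesis
      using 2 by (simp add: gnp_def maj_state_uminus minus_equation_iff[of _ 1] eq_commute)
  qed
qed

theorem theorem1p1:
  fixes \<epsilon> :: real
  assumes "0 < \<epsilon>" and "\<epsilon> \<le> 1"
  shows "\<exists>lam::real > 0. \<exists>n0::nat. \<forall>n > n0. \<forall>p::real.
           lam * real n powr (-1/2) \<le> p \<and> p \<le> 1 \<longrightarrow>
           measure_pmf.prob (pair_pmf (gnp n p) (init_states n))
             {(G, S0). \<forall>v\<in>vertices n.
                maj_state n G S0 4 v = sgn (\<Sum>u\<in>vertices n. S0 u)}
           \<ge> 1 - \<epsilon>"
proof -
  \<comment> \<open>The failure budget is \<epsilon>/4 each for 2 c, for 1 / sqrt n, for the
    second-round term, and for the two exponential terms together. The first fixes \<open>c\<close>;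
    then c lam = 12500 / \<epsilon> makes the third small enough.\<close>
  define lam where "lam = 100000 / \<epsilon>\<^sup>2"
  define c where "c = \<epsilon> / 8"
  have c: "0 < c" "c \<le> 1" using assms by (auto simp: c_def)
  have \<epsilon>2: "\<epsilon>\<^sup>2 \<le> \<epsilon>" "\<epsilon>\<^sup>2 \<le> 1"
    using assms by (auto simp: power2_eq_square mult_left_le mult_le_one)
  have lam: "100000 \<le> lam" using assms \<epsilon>2 by (simp add: lam_def field_simps)
  have clam: "20 \<le> c * lam" using assms by (simp add: c_def lam_def power2_eq_square field_simps)
  have clam2: "26214400 / (c * lam)\<^sup>2 \<le> \<epsilon> / 4"
    using assms \<epsilon>2 by (simp add: c_def lam_def power2_eq_square field_simps)
  have "((\<lambda>n. real n * exp (1 / 2 - sqrt n) + exp (- real n)) \<longlongrightarrow> 0) sequentially"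
    by real_asymp
  then have ev1: "\<forall>\<^sub>F n in sequentially. real n * exp (1 / 2 - sqrt n) + exp (- real n) < \<epsilon> / 4"
    using assms by (intro order_tendstoD) auto
  have "((\<lambda>n. 1 / sqrt (real n)) \<longlongrightarrow> 0) sequentially"
    by real_asymp
  then have ev2: "\<forall>\<^sub>F n in sequentially. 1 / sqrt (real n) < \<epsilon> / 4"
    using assms by (intro order_tendstoD) auto
  obtain n0 where n0: "\<And>n. n0 \<le> n \<Longrightarrow> real n * exp (1 / 2 - sqrt n) + exp (- real n) < \<epsilon> / 4 \<and> 1 / sqrt (real n) < \<epsilon> / 4"
    using eventually_conj[OF ev1 ev2] unfolding eventually_sequentially by blast
  have main: "1 - \<epsilon> \<le> Pr (pair_pmf (gnp n p) (init_states n))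
      {(G, S0). \<forall>v\<in>vertices n. maj_state n G S0 4 v = sgn (\<Sum>u\<in>vertices n. S0 u)}"
    if n: "n0 < n" and p: "lam * real n powr (-1/2) \<le> p" "p \<le> 1" for n p
  proof -
    have npos: "0 < n" using n by simp
    have p0: "0 \<le> p" using p(1) lam by (meson order_trans powr_ge_zero mult_nonneg_nonneg zero_le_numeral)
    have lp: "lam \<le> p * sqrt n"
    proof -
      have "real n powr (-1/2) * sqrt n = 1"
        using npos by (simp add: powr_half_sqrt[symmetric] powr_add[symmetric])
      then have "lam = lam * real n powr (-1/2) * sqrt n" by simp
      also have "\<dots> \<le> p * sqrt n" using p by (intro mult_right_mono) auto
      finally show ?thesis .
    qed
    have x: "20 \<le> c * p * sqrt n"
      using clam mult_left_mono[OF lp, of c] c unfolding mult.assoc by linarith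
    define \<delta> where "\<delta> = 26214400 / (c\<^sup>2 * p\<^sup>2 * n) + n * exp (1 / 2 - p * n / 4) + 4 ^ n * exp (- ((p * n)\<^sup>2 / 320))"
    have sq: "lam\<^sup>2 \<le> p\<^sup>2 * n"
    proof -
      have "lam\<^sup>2 \<le> (p * sqrt n)\<^sup>2" using lp lam by (intro power_mono) auto
      then show ?thesis by (simp add: power_mult_distrib)
    qed
    have d1: "26214400 / (c\<^sup>2 * p\<^sup>2 * n) \<le> \<epsilon> / 4"
    proof -
      have "(c * lam)\<^sup>2 \<le> c\<^sup>2 * p\<^sup>2 * n" using mult_left_mono[OF sq, of "c\<^sup>2"] by (simp add: power_mult_distrib mult.assoc)
      then have "26214400 / (c\<^sup>2 * p\<^sup>2 * n) \<le> 26214400 / (c * lam)\<^sup>2"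
        using c lam by (intro frac_le) auto
      then show ?thesis using clam2 by linarith
    qed
    have d2: "n * exp (1 / 2 - p * n / 4) \<le> n * exp (1 / 2 - sqrt n)"
    proof -
      \<comment> \<open>From 4 \<le> lam \<le> p sqrt n.\<close>
      have "4 * sqrt n \<le> p * sqrt n * sqrt n" using lp lam by (intro mult_right_mono) auto
      then have "4 * sqrt n \<le> p * n" by (simp add: mult.assoc)
      then show ?thesis by (intro mult_left_mono) auto
    qed
    have d3: "4 ^ n * exp (- ((p * n)\<^sup>2 / 320)) \<le> exp (- real n)"
    proof -
      \<comment> \<open>960 = 3 * 320 gives the exponent 3 n, against \<open>4 ^ n\<close> \<le> exp
        (2 n).\<close>
      have "960 \<le> lam" using lam by simp
      also have "lam \<le> lam\<^sup>2" using lam by (simp add: power2_eq_square)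
      finally have "960 * real n \<le> p\<^sup>2 * n * n" using sq by (intro mult_right_mono) auto
      then have "exp (- ((p * n)\<^sup>2 / 320)) \<le> exp (- 3 * real n)"
        by (simp add: power2_eq_square mult_ac)
      moreover have "(4::real) ^ n \<le> exp (2 * real n)"
      proof -
        have "(4::real) = 2 ^ 2" by simp
        also have "\<dots> \<le> exp 1 ^ 2" using exp_ge_add_one_self[of "1::real"] by (intro power_mono) auto
        also have "\<dots> = exp 2" by (simp flip: exp_of_nat_mult)
        finally have "(4::real) ^ n \<le> exp 2 ^ n" by (intro power_mono) auto
        then show ?thesis by (simp add: mult.commute flip: exp_of_nat_mult)
      qed
      ultimately have "4 ^ n * exp (- ((p * n)\<^sup>2 / 320)) \<le> exp (2 * real n) * exp (- 3 * real n)"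
        by (intro mult_mono) auto
      then show ?thesis by (simp flip: exp_add)
    qed
    have \<delta>0: "0 \<le> \<delta>"
      unfolding \<delta>_def by (intro add_nonneg_nonneg) auto
    have \<delta>: "\<delta> \<le> \<epsilon> / 2"
      unfolding \<delta>_def using d1 d2 d3 n0[OF less_imp_le[OF n]] by linarith
    have fin: "finite (set_pmf (gnp n p))" "finite (set_pmf (init_states n))"
      unfolding gnp_def set_init_states by (auto intro: finite_set_bits finite_pairs finite_init_support)
    let ?good = "\<lambda>G S0. \<forall>v\<in>vertices n. maj_state n G S0 4 v = sgn (\<Sum>u\<in>vertices n. S0 u)"
    let ?small = "\<lambda>S. \<bar>of_int (\<Sum>u\<in>vertices n. S u)\<bar> < c * sqrt n"
    \<comment> \<open>The exceptional initial states are those with a sum below c sqrt n in absolute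
      value.\<close>
    have "Pr (pair_pmf (gnp n p) (init_states n)) {(G, S0). \<not> ?good G S0} \<le> Pr (init_states n) {S. ?small S} + \<delta>"
      using prob_wrong_given_init[OF p0 p(2) _ c _ x]
      by (intro prob_pair_le[OF fin _ \<delta>0]) (simp only: \<delta>_def not_less)
    also have "\<dots> \<le> (2 * c + 1 / sqrt n) + \<epsilon> / 2"
      using prob_init_sum_small[OF npos, of c] c \<delta> by (intro add_mono) auto
    also have "\<dots> \<le> \<epsilon>" using n0[of n] n by (simp add: c_def)
    finally have "Pr (pair_pmf (gnp n p) (init_states n)) {(G, S0). \<not> ?good G S0} \<le> \<epsilon>" .
    moreover have "{(G, S0). \<not> ?good G S0} = UNIV - {(G, S0). ?good G S0}" by auto
    ultimately show ?thesis
      using measure_pmf.prob_compl[of "{(G, S0). ?good G S0}" "pair_pmf (gnp n p) (init_states n)"] by simp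
  qed
  show ?thesis
    using lam main by (intro exI[of _ lam] conjI exI[of _ n0] allI impI) auto
qed

end
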